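(* Let $d\ge 2$, $\mu>-1$, $\lambda>0$, and let $\langle\cdot,\cdot\rangle_\mu^S$ be the Sobolev inner product on the unit ball defined in the context. Put $\delta=\frac{d-2}{2}$, $\beta_j^n=n-2j+\delta$, $A_0=\lambda\,2^{\delta+\mu+2}\frac{\omega_\mu}{\sigma_d}$ and, for integers $n\ge 0$ and $0\le j\le n/2$, $$M_{n-2j}=2^{n-2j}A_0\begin{pmatrix}(n-2j)^2&4(n-2j)\\4(n-2j)&16\end{pmatrix}.$$ For each integer $k\ge0$ fix a basis $\{Y^k_\nu:1\le\nu\le a_k^d\}$ of the space $\mathcal H_k^d$ of harmonic homogeneous polynomials of degree $k$, orthonormal on the sphere. Define $$Q^n_{j,\nu}(x)=q_j^{(\mu,\beta_j^n;M_{n-2j})}(2\|x\|^2-1)\,Y_\nu^{n-2j}(x).$$ Then for every $n\ge0$ the set $\{Q^n_{j,\nu}:0\le j\le n/2,\ 1\le\nu\le a_{n-2j}^d\}$ is a mutually orthogonal basis (with respect to $\langle\cdot,\cdot\rangle^S_\mu$) of $\mathcal V_n^d(W_\mu,S)$, the linear space of polynomials of degree $n$ that are orthogonal to all polynomials of lower degree with respect to $\langle\cdot,\cdot\rangle_\mu^S$. Moreover, $$\langle Q^n_{j,\nu},Q^n_{j,\nu}\rangle_\mu^S=\frac{\lambda}{2^{n-2j}A_0}\,\tilde h_j^{(\mu,\beta_j^n;M_{n-2j})},\qquad\text{where } \tilde h_j^{(\mu,\beta;M)}=\big(q_j^{(\mu,\beta;M)},q_j^{(\mu,\beta;M)}\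big)^S_{[\mu,\beta;M]}.$$
   Context: $\mathbb B^d=\{x\in\mathbb R^d:\|x\|\le1\}$, $\mathbb S^{d-1}=\{\xi\in\mathbb R^d:\|\xi\|=1\}$, $d\sigma$ is surface measure on $\mathbb S^{d-1}$, $\sigma_d=\int_{\mathbb S^{d-1}}d\sigma=2\pi^{d/2}/\Gamma(d/2)$, $W_\mu(x)=(1-\|x\|^2)^\mu$, and $\omega_\mu=\int_{\mathbb B^d}W_\mu(x)\,dx=\pi^{d/2}\Gamma(\mu+1)/\Gamma(\mu+d/2+1)$. The Sobolev inner product on real polynomials in $d$ variables is $$\langle f,g\rangle_\mu^S=\frac1{\omega_\mu}\int_{\mathbb B^d}f(x)g(x)W_\mu(x)\,dx+\frac{\lambda}{\sigma_d}\int_{\mathbb S^{d-1}}\frac{\partial f}{\partial\mathbf n}(\xi)\frac{\partial g}{\partial\mathbf n}(\xi)\,d\sigma(\xi),\qquad \frac{\partial f}{\partial\mathbf n}=\sum_{i=1}^dx_i\frac{\partial f}{\partial x_i}\ \text{ on }\mathbb S^{d-1}.$$ The zero polynomial is included in $\mathcal V_n^d(W_\mu,S)$. $\mathcal H_k^d$ is the space of homogeneous polynomials of degree $k$ in $d$ variables with $\Delta Y=0$; $a_k^d=\dim\mathcal H_k^d$; orthonormality is with respect to $\frac1{\sigma_d}\int_{\mathbb S^{d-1}}fg\,d\sigma$. For $\alpha,\beta>-1$ and a $2\times2$ real symmetric positive semidefinite matrix $M$, $$(f,g)^S_{[\alpha,\beta;M]}=\int_{-1}^1f(t)g(t)(1-t)^\alpha(1+t)^\beta\,dt+\mathbf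 f(1)\,M\,\mathbf g(1)^t,\qquad \mathbf f(1)=(f(1),f'(1)),$$ and $\{q_j^{(\alpha,\beta;M)}\}_{j\ge0}$ is the corresponding sequence of univariate orthogonal polynomials ($q_j$ of exact degree $j$), normalized so that the leading coefficient of $q_j^{(\alpha,\beta;M)}$ is $2^{-j}\binom{2j+\alpha+\beta}{j}$, that of the Jacobi polynomial $P_j^{(\alpha,\beta)}$. *)

theory Defs
  imports "HOL-Analysis.Analysis" "HOL-Library.Function_Algebras" "HOL-Computational_Algebra.Polynomial"
begin

(* Real-valued functions form a real vector space pointwise, so that span, independent
   and dim of HOL.Real_Vector_Spaces apply to sets of polynomial functions. *)

instantiation "fun" :: (type, real_vector) real_vector
begin

definition scaleR_fun :: "real \<Rightarrow> ('a \<Rightarrow> 'b) \<Rightarrow> 'a \<Rightarrow> 'b" where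
  "scaleR_fun c f = (\<lambda>x. c *\<^sub>R f x)"

instance
  by standard (auto simp: scaleR_fun_def fun_eq_iff plus_fun_def scaleR_add_right scaleR_add_left)

end


(* Polynomials in d = CARD('n) real variables are identified with the functions they
   induce on real^'n, which is faithful because the field of reals is infinite. *)

definition monomial :: "('n \<Rightarrow> nat) \<Rightarrow> real ^ 'n::finite \<Rightarrow> real" where
  "monomial a x = (\<Prod>i\<in>UNIV. (x $ i) ^ a i)"

(* The zero polynomial belongs to both of the following spaces. *)

definition polys_upto :: "nat \<Rightarrow> (real ^ 'n::finite \<Rightarrow> real) set" where
  "polys_upto m = span {monomial a |a. (\<Sum>i\<in>UNIV. a i) \<le> m}"

definition homogeneous_polys :: "nat \<Rightarrow> (real ^ 'n::finite \<Rightarrow> real) set" where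
  "homogeneous_polys k = span {monomial a |a. (\<Sum>i\<in>UNIV. a i) = k}"

(* Total degree. As for Polynomial.degree, the zero polynomial gets degree 0. *)

definition total_degree :: "(real ^ 'n::finite \<Rightarrow> real) \<Rightarrow> nat" where
  "total_degree f = (LEAST m. f \<in> polys_upto m)"

lemma real_polynomial_function_iff_polys_upto:
  fixes f :: "real ^ 'n::finite \<Rightarrow> real"
  shows "real_polynomial_function f \<longleftrightarrow> (\<exists>m. f \<in> polys_upto m)"
proof
  have const: "(\<lambda>x::real^'n. 1) = monomial (\<lambda>i. 0)"
    by (simp add: monomial_def fun_eq_iff)
  have monomul: "monomial a x * monomial b x = monomial (\<lambda>i. a i + b i) x" for a b and x :: "real^'n"
    by (simp add: monomial_def power_add prod.distrib)
  have mono: "polys_upto m \<subseteq> polys_upto m'" if "m \<le> m'" for m m'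
    unfolding polys_upto_def using that by (intro span_mono) auto
  have var: "(\<lambda>x. x $ i) = monomial (\<lambda>j. if j = i then 1 else 0)" for i :: 'n
  proof
    fix x :: "real^'n"
    have "monomial (\<lambda>j. if j = i then 1 else 0) x = (\<Prod>j\<in>UNIV. if j = i then x $ j else 1)"
      unfolding monomial_def by (intro prod.cong) auto
    then show "x $ i = monomial (\<lambda>j. if j = i then 1 else 0) x" by simp
  qed
  have mult: "(\<lambda>x. f x * g x) \<in> polys_upto (m + m')"
    if f: "f \<in> polys_upto m" and g: "g \<in> polys_upto m'" for f g :: "real^'n \<Rightarrow> real" and m m'
  proof -
    have s: "(\<lambda>x. monomial a x * g x) \<in> polys_upto (m + m')" if a: "(\<Sum>i\<in>UNIV. a i) \<le> m" for a :: "'n \<Rightarrow> nat"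
      using g unfolding polys_upto_def
    proof (induction rule: span_induct_alt)
      case base
      have "(\<lambda>x. monomial a x * (0::real^'n \<Rightarrow> real) x) = 0" by (simp add: fun_eq_iff)
      then show ?case by (simp add: span_zero)
    next
      case (step c u g)
      then obtain b where b: "u = monomial b" "(\<Sum>i\<in>UNIV. b i) \<le> m'" by auto
      have "(\<lambda>x. monomial a x * (c *\<^sub>R u + g) x) = c *\<^sub>R monomial (\<lambda>i. a i + b i) + (\<lambda>x. monomial a x * g x)"
        using b by (auto simp: fun_eq_iff scaleR_fun_def plus_fun_def algebra_simps monomul[symmetric])
      moreover have "monomial (\<lambda>i. a i + b i) \<in> span {monomial a |a. (\<Sum>i\<in>UNIV. a i) \<le> m + m'}"
        using a b by (intro span_base) (auto intro!: exI[of _ "\<lambda>i. a i + b i"] simp: sum.distrib)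
      ultimately show ?case using step by (auto intro!: span_add span_scale)
    qed
    show ?thesis using f unfolding polys_upto_def
    proof (induction rule: span_induct_alt)
      case base
      have "(\<lambda>x. (0::real^'n \<Rightarrow> real) x * g x) = 0" by (simp add: fun_eq_iff)
      then show ?case by (simp add: span_zero)
    next
      case (step c u f)
      then obtain b where b: "u = monomial b" "(\<Sum>i\<in>UNIV. b i) \<le> m" by auto
      have "(\<lambda>x. (c *\<^sub>R u + f) x * g x) = c *\<^sub>R (\<lambda>x. monomial b x * g x) + (\<lambda>x. f x * g x)"
        using b by (auto simp: fun_eq_iff scaleR_fun_def plus_fun_def algebra_simps)
      then show ?case using step s[OF b(2)] by (auto intro!: span_add span_scale simp: polys_upto_def)
    qed
  qed
  show "\<exists>m. f \<in> polys_upto m" if "real_polynomial_function f"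
    using that
  proof induction
    case (linear f)
    have "f = (\<Sum>i\<in>UNIV. f (axis i 1) *\<^sub>R (\<lambda>x. x $ i))"
    proof
      fix x
      have "f x = f (\<Sum>i\<in>UNIV. x $ i *\<^sub>R axis i 1)"
        by (simp add: basis_expansion flip: scalar_mult_eq_scaleR)
      also have "\<dots> = (\<Sum>i\<in>UNIV. x $ i * f (axis i 1))"
        using linear by (simp add: linear_simps linear_sum bounded_linear.linear)
      also have "\<dots> = (\<Sum>i\<in>UNIV. f (axis i 1) *\<^sub>R (\<lambda>x. x $ i)) x"
      proof -
        have "(\<Sum>i\<in>I. f (axis i 1) *\<^sub>R (\<lambda>x. x $ i)) x = (\<Sum>i\<in>I. x $ i * f (axis i 1))" if "finite I" for I
          using that by induction (auto simp: scaleR_fun_def plus_fun_def zero_fun_def)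
        then show ?thesis by simp
      qed
      finally show "f x = \<dots>" .
    qed
    moreover have "(\<lambda>x. x $ i) \<in> polys_upto 1" for i :: 'n
      unfolding var polys_upto_def by (intro span_base) auto
    ultimately have "f \<in> polys_upto 1"
      unfolding polys_upto_def by (metis (mono_tags, lifting) span_scale span_sum)
    then show ?case ..
  next
    case (const c)
    have "(\<lambda>x::real^'n. c) = c *\<^sub>R monomial (\<lambda>i. 0)"
      by (simp add: scaleR_fun_def const[symmetric] monomial_def)
    also have "\<dots> \<in> polys_upto 0"
      unfolding polys_upto_def by (intro span_scale span_base) auto
    finally show ?case ..
  next
    case (add f g)
    then obtain m m' where "f \<in> polys_upto m" "g \<in> polys_upto m'" by blast
    then have "f \<in> polys_upto (max m m')" "g \<in> polys_upto (max m m')"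
      using mono[of m "max m m'"] mono[of m' "max m m'"] by auto
    then have "f + g \<in> polys_upto (max m m')"
      unfolding polys_upto_def by (rule span_add)
    then show ?case by (auto simp: plus_fun_def)
  next
    case (mult f g)
    then show ?case using \<open>\<And>m m' g f. _ \<Longrightarrow> _ \<Longrightarrow> (\<lambda>x. f x * g x) \<in> polys_upto (m + m')\<close> by blast
  qed
next
  have pm: "real_polynomial_function (monomial a)" for a :: "'n \<Rightarrow> nat"
    unfolding monomial_def
    by (intro real_polynomial_function_prod real_polynomial_function_power
        real_polynomial_function.intros(1) bounded_linear_vec_nth finite)
  assume "\<exists>m. f \<in> polys_upto m"
  then obtain m where "f \<in> polys_upto m" ..
  then show "real_polynomial_function f" unfolding polys_upto_def
  proof (induction rule: span_induct_alt)
    case base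
    show ?case by (simp add: zero_fun_def real_polynomial_function.intros)
  next
    case (step c u g)
    then have "real_polynomial_function u" using pm by auto
    with step show ?case
      by (auto simp: plus_fun_def scaleR_fun_def intro!: real_polynomial_function.intros(2-))
  qed
qed


definition partial_deriv :: "'n \<Rightarrow> (real ^ 'n::finite \<Rightarrow> real) \<Rightarrow> real ^ 'n \<Rightarrow> real" where
  "partial_deriv i f x = frechet_derivative f (at x) (axis i 1)"

definition laplacian :: "(real ^ 'n::finite \<Rightarrow> real) \<Rightarrow> real ^ 'n \<Rightarrow> real" where
  "laplacian f x = (\<Sum>i\<in>UNIV. partial_deriv i (partial_deriv i f) x)"

definition normal_deriv :: "(real ^ 'n::finite \<Rightarrow> real) \<Rightarrow> real ^ 'n \<Rightarrow> real" where
  "normal_deriv f x = (\<Sum>i\<in>UNIV. x $ i * partial_deriv i f x)"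

definition harmonic_polys :: "nat \<Rightarrow> (real ^ 'n::finite \<Rightarrow> real) set" where
  "harmonic_polys k = {f \<in> homogeneous_polys k. \<forall>x. laplacian f x = 0}"


(* Surface measure on the unit sphere: the measure of A is d times the Lebesgue measure of
   the cone over A, i.e. of the set of x in the ball with x /R norm x in A (sgn x = x /R norm x).
   The two lemmas below spell this out and confirm the usual total mass. *)

definition sphere_measure :: "(real ^ 'n::finite) measure" where
  "sphere_measure = scale_measure (of_nat CARD('n))
     (distr (restrict_space lborel (cball 0 1 - {0})) (restrict_space borel (sphere 0 1)) sgn)"

lemma emeasure_sphere_measure:
  fixes A :: "(real ^ 'n::finite) set"
  assumes "A \<in> sets borel" "A \<subseteq> sphere 0 1"
  shows "emeasure sphere_measure A =
           of_nat CARD('n) * emeasure lborel {x \<in> cball 0 1 - {0}. sgn x \<in> A}"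
proof -
  have "sgn \<in> borel_measurable (restrict_space (borel :: (real^'n) measure) (cball 0 1 - {0}))"
    by (intro borel_measurable_continuous_on_restrict) (auto simp: sgn_div_norm[abs_def] intro!: continuous_intros)
  then have m: "sgn \<in> measurable (restrict_space lborel (cball (0::real^'n) 1 - {0})) (restrict_space borel (sphere 0 1))"
    by (intro measurable_restrict_space2)
       (auto simp: space_restrict_space norm_sgn cong: measurable_cong_sets sets_restrict_space_cong)
  have "A \<in> sets (restrict_space borel (sphere 0 1))"
    using assms by (auto simp: sets_restrict_space)
  then show ?thesis
    using m by (auto simp: sphere_measure_def emeasure_distr space_restrict_space emeasure_restrict_space
        intro!: arg_cong2[where f="(*)"] arg_cong2[where f=emeasure])
qed

lemma measure_sphere_measure:
  "measure sphere_measure (sphere (0 :: real ^ 'n::finite) 1) =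
     2 * pi powr (real CARD('n) / 2) / Gamma (real CARD('n) / 2)"
proof -
  let ?d = "real CARD('n)"
  have "{x \<in> cball (0::real^'n) 1 - {0}. sgn x \<in> sphere 0 1} = cball 0 1 - {0}"
    by (auto simp: norm_sgn)
  moreover have "emeasure lborel (cball (0::real^'n) 1 - {0}) = emeasure lborel (cball (0::real^'n) 1)"
    by (subst emeasure_Diff) auto
  ultimately have "measure sphere_measure (sphere (0 :: real ^ 'n) 1) = ?d * unit_ball_vol ?d"
    using emeasure_sphere_measure[of "sphere (0::real^'n) 1"]
    by (simp add: measure_def emeasure_cball enn2real_mult)
  also have "\<dots> = ?d * (pi powr (?d / 2) / (?d / 2 * Gamma (?d / 2)))"
  proof -
    have "?d / 2 \<notin> \<int>\<^sub>\<le>\<^sub>0"       using nonpos_Ints_nonpos[of "?d / 2"] by fastforce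
    then show ?thesis by (simp add: unit_ball_vol_def Gamma_plus1)
  qed
  finally show ?thesis by (simp add: field_simps)
qed

(* The constants sigma_d and omega_mu; the argument of type itself carries d = CARD('n). *)

definition sphere_area :: "'n::finite itself \<Rightarrow> real" where
  "sphere_area _ = (LINT x | (sphere_measure :: (real ^ 'n) measure). 1)"

definition ball_weight :: "real \<Rightarrow> real ^ 'n::finite \<Rightarrow> real" where
  "ball_weight mu x = (1 - (norm x)\<^sup>2) powr mu"

definition ball_mass :: "'n::finite itself \<Rightarrow> real \<Rightarrow> real" where
  "ball_mass _ mu = (LBINT x : cball (0 :: real ^ 'n) 1. ball_weight mu x)"

definition sphere_inner :: "(real ^ 'n::finite \<Rightarrow> real) \<Rightarrow> (real ^ 'n \<Rightarrow> real) \<Rightarrow> real" where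
  "sphere_inner f g = (LINT x | sphere_measure. f x * g x) / sphere_area TYPE('n)"

definition ball_sobolev_inner ::
    "real \<Rightarrow> real \<Rightarrow> (real ^ 'n::finite \<Rightarrow> real) \<Rightarrow> (real ^ 'n \<Rightarrow> real) \<Rightarrow> real" where
  "ball_sobolev_inner mu lam f g =
     1 / ball_mass TYPE('n) mu * (LBINT x : cball 0 1. f x * g x * ball_weight mu x)
     + lam / sphere_area TYPE('n) * (LINT x | sphere_measure. normal_deriv f x * normal_deriv g x)"

definition sobolev_orth_polys :: "real \<Rightarrow> real \<Rightarrow> nat \<Rightarrow> (real ^ 'n::finite \<Rightarrow> real) set" where
  "sobolev_orth_polys mu lam n =
     {f. real_polynomial_function f \<and> (f = 0 \<or> total_degree f = n) \<and>
         (\<forall>g. real_polynomial_function g \<and> total_degree g < n \<longrightarrow> ball_sobolev_inner mu lam f g = 0)}"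


definition jacobi_sobolev_inner ::
    "real \<Rightarrow> real \<Rightarrow> real ^ 2 ^ 2 \<Rightarrow> real poly \<Rightarrow> real poly \<Rightarrow> real" where
  "jacobi_sobolev_inner \<alpha> \<beta> M f g =
     (LBINT t : {-1..1}. poly f t * poly g t * (1 - t) powr \<alpha> * (1 + t) powr \<beta>)
     + (vector [poly f 1, poly (pderiv f) 1] v* M) \<bullet> vector [poly g 1, poly (pderiv g) 1]"

definition is_jacobi_sobolev_seq ::
    "real \<Rightarrow> real \<Rightarrow> real ^ 2 ^ 2 \<Rightarrow> (nat \<Rightarrow> real poly) \<Rightarrow> bool" where
  "is_jacobi_sobolev_seq \<alpha> \<beta> M q \<longleftrightarrow>
     (\<forall>j. degree (q j) = j \<and> lead_coeff (q j) = ((2 * real j + \<alpha> + \<beta>) gchoose j) / 2 ^ j) \<and>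
     (\<forall>i j. i \<noteq> j \<longrightarrow> jacobi_sobolev_inner \<alpha> \<beta> M (q i) (q j) = 0)"

(* For alpha, beta > -1 and symmetric positive semidefinite M the inner product is positive
   definite and the leading coefficients above are nonzero, so exactly one such sequence exists. *)

definition jacobi_sobolev :: "real \<Rightarrow> real \<Rightarrow> real ^ 2 ^ 2 \<Rightarrow> nat \<Rightarrow> real poly" where
  "jacobi_sobolev \<alpha> \<beta> M = (THE q. is_jacobi_sobolev_seq \<alpha> \<beta> M q)"


definition indexed_basis :: "('a::real_vector) set \<Rightarrow> 'i set \<Rightarrow> ('i \<Rightarrow> 'a) \<Rightarrow> bool" where
  "indexed_basis V I b \<longleftrightarrow> inj_on b I \<and> independent (b ` I) \<and> span (b ` I) = V"

end

(*
  A polynomial p(2|x|^2 - 1) Y(x) with Y a harmonic homogeneous polynomial of degree k separates: the ball integral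
  of a product of two of them is a Jacobi integral in t = 2|x|^2 - 1 times the spherical inner product of the
  harmonics, and on the sphere the normal derivative is (k p(1) + 4 p'(1)) Y. The resulting quadratic form in
  (p(1), p'(1)) is the rank one matrix M_k, so orthogonality and the norm formula reduce to the univariate
  Sobolev polynomials and to the orthogonality of harmonics of different degrees. Spanning follows from the
  decomposition of every homogeneous polynomial into the |x|^(2j) Y with Y harmonic.
  Both facts about harmonics come from one integration by parts on the ball, with weight (1 - |x|^2)^2 so that no
  boundary term appears: for homogeneous f, g of degrees k, l,
    int (Lap f g - f Lap g) (1 - |x|^2)^2 = 4 (k - l) int f g (1 - |x|^2).
*)
theory Submission
  imports Defs
begin

section \<open>Symmetric bilinear forms\<close>


text \<open>The surface measure is given through cones over subsets of the sphere, so polar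
  coordinates have to be derived: the image of the measure H(sgn x) dx on the ball under x -> |x|^2
  is identified with a power density on [0,1]. With v = |x|^2 and t = 2v - 1, a product of two
  harmonics of degree k contributes v^k and hence the Jacobi exponent k + \<delta>; the powers of 2
  released by this substitution are what \<open>A0\<close> and the factor \<open>2 ^ k\<close> in
  \<open>M k\<close> compensate. The spherical inner product is degenerate on the space of all
  polynomials, since |x|^2 - 1 vanishes on the sphere, but definite on each homogeneous space;
  projections are therefore taken inside one degree. Forms given by integrals are additive only
  where the products are integrable, which is why the abstract theory carries a subspace
  \<open>V\<close>. A member of the orthogonal space must be zero or have degree exactly n. This is
  obtained by treating the families of all degrees at once: a polynomial of degree m orthogonal to
  every family of degree at most m is zero.\<close>

locale symmetric_form = vector_space scale
  for scale :: "'a::field \<Rightarrow> 'b::ab_group_add \<Rightarrow> 'b" +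
  fixes V :: "'b set" and B :: "'b \<Rightarrow> 'b \<Rightarrow> 'a"
  assumes subspace_carrier: "subspace V"
    and form_add: "\<lbrakk>f \<in> V; g \<in> V; h \<in> V\<rbrakk> \<Longrightarrow> B (f + g) h = B f h + B g h"
    and form_scale: "\<lbrakk>f \<in> V; h \<in> V\<rbrakk> \<Longrightarrow> B (scale c f) h = c * B f h"
    and form_commute: "\<lbrakk>f \<in> V; h \<in> V\<rbrakk> \<Longrightarrow> B f h = B h f"
begin

lemma form_zero: "h \<in> V \<Longrightarrow> B 0 h = 0"
  using form_scale[of 0 h 0] subspace_0[OF subspace_carrier] by simp

lemma form_diff:
  assumes "f \<in> V" "g \<in> V" "h \<in> V"
  shows "B (f - g) h = B f h - B g h"
proof -
  have "B ((f - g) + g) h = B (f - g) h + B g h"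
    by (rule form_add) (use assms subspace_diff[OF subspace_carrier] in auto)
  then show ?thesis by simp
qed

lemma span_carrier: "S \<subseteq> V \<Longrightarrow> span S \<subseteq> V"
  using span_minimal subspace_carrier by blast

lemma orthogonal_to_span:
  assumes "S \<subseteq> V" "f \<in> V" "\<And>s. s \<in> S \<Longrightarrow> B f s = 0" "g \<in> span S"
  shows "B f g = 0"
proof -
  have "subspace {x \<in> V. B x f = 0}"
    using subspace_carrier assms(2)
    by (auto simp: subspace_def form_add form_scale form_zero)
  moreover have "S \<subseteq> {x \<in> V. B x f = 0}"
    using assms by (auto simp: form_commute subset_iff)
  ultimately have "span S \<subseteq> {x \<in> V. B x f = 0}"
    by (rule span_minimal[rotated])
  then show ?thesis using assms form_commute[of f g] by auto
qed

text \<open>Gram-Schmidt by induction on \<open>S\<close>, over any field: only the absence of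
  nonzero self-orthogonal vectors is used, no positivity. The induction hypothesis is applied to
  \<open>f\<close> and to the new vector \<open>x\<close>; the residual of \<open>x\<close> supplies
  the one additional direction.\<close>

lemma orthogonal_projection_exists:
  assumes "finite S" "S \<subseteq> V" "f \<in> V" and nondeg: "\<And>v. \<lbrakk>v \<in> V; B v v = 0\<rbrakk> \<Longrightarrow> v = 0"
  shows "\<exists>w \<in> span S. \<forall>s \<in> span S. B (f - w) s = 0"
  using assms(1-3)
proof (induction S arbitrary: f rule: finite_induct)
  case empty
  then have "B f 0 = 0"
    using form_commute[of f 0] form_zero subspace_0[OF subspace_carrier] by simp
  then show ?case by simp
next
  case (insert x S)
  then have S: "S \<subseteq> V" and x: "x \<in> V" by auto
  have sV: "span S \<subseteq> V" using S by (rule span_carrier)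
  obtain w where w: "w \<in> span S" "\<forall>s \<in> span S. B (f - w) s = 0"
    using insert.IH[OF S insert.prems(2)] by blast
  obtain v where v: "v \<in> span S" "\<forall>s \<in> span S. B (x - v) s = 0"
    using insert.IH[OF S x] by blast
  define y where "y = x - v"
  have V: "f - w \<in> V" "y \<in> V"
    using w v sV x insert.prems subspace_diff[OF subspace_carrier] unfolding y_def by blast+
  \<comment> \<open>If \<open>y = 0\<close>, the new vector already lies in the span of
    \<open>S\<close>, and the old projection needs no correction.\<close>
  define c where "c = (if y = 0 then 0 else B (f - w) y / B y y)"
  define u where "u = w + scale c y"
  have cy: "scale c y \<in> V" using subspace_scale[OF subspace_carrier V(2)] .
  have xI: "x \<in> span (insert x S)" by (simp add: span_base)
  have SI: "span S \<subseteq> span (insert x S)" by (rule span_mono) auto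
  have "u \<in> span (insert x S)"
    unfolding u_def y_def using w(1) v(1) xI SI by (intro span_add span_scale span_diff) auto
  moreover have "B (f - u) s = 0" if "s \<in> span (insert x S)" for s
  proof -
    have fu: "f - u = (f - w) - scale c y" by (simp add: u_def)
    have fuV: "f - u \<in> V" unfolding fu using V cy subspace_diff[OF subspace_carrier] by blast
    have orth: "B (f - u) s = 0" if "s \<in> span S" for s
    proof -
      have "s \<in> V" using that sV by blast
      then show ?thesis
        unfolding fu using that w(2) v(2) V cy by (simp add: form_diff form_scale y_def)
    qed
    have "B (f - u) y = 0"
    proof (cases "y = 0")
      case True
      then show ?thesis using fuV form_commute[of "f - u" 0] V form_zero by simp
    next
      case False
      then have "B y y \<noteq> 0" using nondeg V by blast
      then show ?thesis
        unfolding fu using V cy False by (simp add: form_diff form_scale c_def)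
    qed
    moreover have "B v (f - u) = 0"
      using orth[OF v(1)] form_commute[of v "f - u"] v(1) sV fuV by auto
    moreover have "B y (f - u) = B x (f - u) - B v (f - u)"
      unfolding y_def using x v(1) sV fuV by (intro form_diff) auto
    ultimately have "B x (f - u) = 0"
      using form_commute[OF fuV V(2)] by simp
    then have "B (f - u) x = 0" using form_commute[OF fuV x] by simp
    then have "B (f - u) t = 0" if "t \<in> insert x S" for t
      using that orth span_base[of t S] by blast
    then show ?thesis
      using orthogonal_to_span[of "insert x S" "f - u" s] fuV insert.prems(1) that by blast
  qed
  ultimately show ?case by blast
qed

lemma orthogonal_imp_independent:
  assumes "S \<subseteq> V" "\<And>s. s \<in> S \<Longrightarrow> B s s \<noteq> 0"
    and "\<And>s t. \<lbrakk>s \<in> S; t \<in> S; s \<noteq> t\<rbrakk> \<Longrightarrow> B s t = 0"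
  shows "independent S"
proof
  assume "dependent S"
  then obtain s where s: "s \<in> S" "s \<in> span (S - {s})" by (auto simp: dependent_def)
  have "B s s = 0"
    by (rule orthogonal_to_span[of "S - {s}"]) (use s assms in auto)
  then show False using assms s by blast
qed

text \<open>Pairing an expansion of \<open>f\<close> with a member \<open>s\<close> of
  \<open>S\<close> isolates the coefficient of \<open>s\<close>, which must then vanish. The choice
  of \<open>T\<close> as the family of top degree yields spanning, and \<open>T = {}\<close> yields
  \<open>f = 0\<close>.\<close>

lemma orthogonal_complement_in_span:
  assumes "S \<union> T \<subseteq> V" "\<And>s. s \<in> S \<union> T \<Longrightarrow> B s s \<noteq> 0"
    and "\<And>s t. \<lbrakk>s \<in> S \<union> T; t \<in> S \<union> T; s \<noteq> t\<rbrakk> \<Longrightarrow> B s t = 0"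
    and f: "f \<in> span (S \<union> T)" and orth: "\<And>s. s \<in> S \<Longrightarrow> B f s = 0"
  shows "f \<in> span T"
proof -
  obtain F r where F: "finite F" "F \<subseteq> S \<union> T" "f = (\<Sum>a\<in>F. scale (r a) a)"
    using f unfolding span_explicit by blast
  have FV: "F \<subseteq> V" using F assms by blast
  have zero: "r s = 0" if s: "s \<in> F" "s \<in> S" for s
  proof -
    have sV: "s \<in> V" using s FV by blast
    have sum: "B (\<Sum>a\<in>G. scale (r a) a) s = (\<Sum>a\<in>G. r a * B a s)" if "finite G" "G \<subseteq> V" for G
      using that
    proof (induction G)
      case (insert a G)
      have "(\<Sum>a\<in>G. scale (r a) a) \<in> V"
        using insert subspace_carrier by (intro subspace_sum subspace_scale) auto
      with insert show ?case
        using sV subspace_scale[OF subspace_carrier] by (simp add: form_add form_scale)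
    qed (simp add: form_zero sV)
    have "0 = (\<Sum>a\<in>F. r a * B a s)" using orth[OF s(2)] F(3) sum[OF F(1) FV] by simp
    also have "\<dots> = (\<Sum>a\<in>F. if a = s then r s * B s s else 0)"
    proof (intro sum.cong refl)
      fix a assume "a \<in> F"
      then have "B a s = 0" if "a \<noteq> s" using assms(3)[of a s] F(2) s that by blast
      then show "r a * B a s = (if a = s then r s * B s s else 0)" by simp
    qed
    also have "\<dots> = r s * B s s" using F s by simp
    finally show ?thesis using assms(2)[of s] s(2) by simp
  qed
  have "scale (r a) a \<in> span T" if "a \<in> F" for a
  proof (cases "a \<in> T")
    case True
    then show ?thesis by (intro span_scale span_base)
  next
    case False
    then have "r a = 0" using zero that F(2) by blast
    then show ?thesis by (simp add: span_zero)
  qed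
  then show ?thesis unfolding F(3) by (intro span_sum) auto
qed

end

section \<open>Polynomial functions and homogeneity\<close>


lemma sum_fun_apply: "sum g A x = (\<Sum>a\<in>A. g a x)"
  by (induction A rule: infinite_finite_induct) (auto simp: plus_fun_def zero_fun_def)

section \<open>Derivatives of polynomial functions\<close>

lemma real_polynomial_has_derivative:
  fixes f :: "'a::euclidean_space \<Rightarrow> real"
  assumes "real_polynomial_function f"
  shows "(f has_derivative frechet_derivative f (at x)) (at x)"
  using differentiable_at_real_polynomial_function[OF assms] frechet_derivative_works by blast

text \<open>\<open>frechet_derivative\<close> is a choice operator, so the induction instead builds
  an explicit family of derivatives that is polynomial in the base point for each direction.
  Uniqueness of the derivative identifies the two at the end.\<close>

lemma real_polynomial_function_frechet_derivative:
  fixes f :: "'a::euclidean_space \<Rightarrow> real"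
  assumes "real_polynomial_function f"
  shows "real_polynomial_function (\<lambda>x. frechet_derivative f (at x) v)"
proof -
  have "\<exists>f'. (\<forall>x. (f has_derivative f' x) (at x)) \<and> (\<forall>v. real_polynomial_function (\<lambda>x. f' x v))"
    using assms
  proof induction
    case (linear f)
    then show ?case
      by (intro exI[of _ "\<lambda>_. f"])
         (auto intro: bounded_linear_imp_has_derivative real_polynomial_function.intros)
  next
    case (const c)
    show ?case
      by (intro exI[of _ "\<lambda>_ _. 0"]) (auto intro: real_polynomial_function.intros)
  next
    case (add f g)
    then obtain f' g' where
      "\<forall>x. (f has_derivative f' x) (at x)" "\<forall>v. real_polynomial_function (\<lambda>x. f' x v)"
      "\<forall>x. (g has_derivative g' x) (at x)" "\<forall>v. real_polynomial_function (\<lambda>x. g' x v)"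
      by blast
    then show ?case
      by (intro exI[of _ "\<lambda>x v. f' x v + g' x v"])
         (auto intro: has_derivative_add real_polynomial_function.intros)
  next
    case (mult f g)
    then obtain f' g' where
      "\<forall>x. (f has_derivative f' x) (at x)" "\<forall>v. real_polynomial_function (\<lambda>x. f' x v)"
      "\<forall>x. (g has_derivative g' x) (at x)" "\<forall>v. real_polynomial_function (\<lambda>x. g' x v)"
      by blast
    then show ?case using mult
      by (intro exI[of _ "\<lambda>x v. f x * g' x v + f' x v * g x"])
         (auto intro: has_derivative_mult intro!: real_polynomial_function.intros(3,4))
  qed
  then obtain f' where f': "\<And>x. (f has_derivative f' x) (at x)"
    "\<And>v. real_polynomial_function (\<lambda>x. f' x v)" by blast
  have "f' x = frechet_derivative f (at x)" for x
    using frechet_derivative_at[OF f'(1)] .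
  then show ?thesis using f'(2)[of v] by simp
qed

lemma real_polynomial_function_partial_deriv:
  "real_polynomial_function f \<Longrightarrow> real_polynomial_function (partial_deriv i f)"
  using real_polynomial_function_frechet_derivative[of f "axis i 1"]
  by (simp add: partial_deriv_def[abs_def])

lemma normal_deriv_eq_frechet:
  fixes f :: "real ^ 'n::finite \<Rightarrow> real"
  assumes "real_polynomial_function f"
  shows "normal_deriv f x = frechet_derivative f (at x) x"
proof -
  have lin: "linear (frechet_derivative f (at x))"
    using real_polynomial_has_derivative[OF assms] has_derivative_linear by blast
  have "frechet_derivative f (at x) x = frechet_derivative f (at x) (\<Sum>i\<in>UNIV. x $ i *\<^sub>R axis i 1)"
    by (simp add: basis_expansion flip: scalar_mult_eq_scaleR)
  also have "\<dots> = normal_deriv f x"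
    using lin by (simp add: linear_sum linear_scale normal_deriv_def partial_deriv_def)
  finally show ?thesis by simp
qed

lemma partial_deriv_add:
  assumes "real_polynomial_function f" "real_polynomial_function g"
  shows "partial_deriv i (\<lambda>x. f x + g x) x = partial_deriv i f x + partial_deriv i g x"
  using frechet_derivative_at[OF has_derivative_add[OF assms[THEN real_polynomial_has_derivative]], symmetric]
  by (simp add: partial_deriv_def)

lemma partial_deriv_mult:
  assumes "real_polynomial_function f" "real_polynomial_function g"
  shows "partial_deriv i (\<lambda>x. f x * g x) x = f x * partial_deriv i g x + partial_deriv i f x * g x"
  using frechet_derivative_at[OF has_derivative_mult[OF assms[THEN real_polynomial_has_derivative]], symmetric]
  by (simp add: partial_deriv_def)

lemma partial_deriv_cmult:
  assumes "real_polynomial_function f"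
  shows "partial_deriv i (\<lambda>x. c * f x) x = c * partial_deriv i f x"
  using frechet_derivative_at[OF has_derivative_mult_right[OF real_polynomial_has_derivative[OF assms]], symmetric]
  by (simp add: partial_deriv_def)

lemma partial_deriv_diff:
  assumes "real_polynomial_function f" "real_polynomial_function g"
  shows "partial_deriv i (\<lambda>x. f x - g x) x = partial_deriv i f x - partial_deriv i g x"
  using frechet_derivative_at[OF has_derivative_diff[OF assms[THEN real_polynomial_has_derivative]], symmetric]
  by (simp add: partial_deriv_def)

lemma partial_deriv_power_norm:
  "partial_deriv i (\<lambda>x. (norm x)\<^sup>2) (x :: real ^ 'n::finite) = 2 * x $ i"
proof -
  have "((\<lambda>x::real^'n. (norm x)\<^sup>2) has_derivative (\<lambda>v. 2 * (x \<bullet> v))) (at x)"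
    unfolding power2_norm_eq_inner
    by (auto intro!: derivative_eq_intros simp: inner_commute)
  from frechet_derivative_at[OF this, symmetric] show ?thesis
    by (simp add: partial_deriv_def inner_axis)
qed

lemma real_polynomial_function_power_norm:
  "real_polynomial_function (\<lambda>x :: real ^ 'n::finite. (norm x)\<^sup>2)"
proof -
  have "(\<lambda>x :: real ^ 'n. (norm x)\<^sup>2) = (\<lambda>x. \<Sum>i\<in>UNIV. x $ i * x $ i)"
    by (auto simp: power2_norm_eq_inner inner_vec_def)
  moreover have "real_polynomial_function (\<lambda>x :: real ^ 'n. \<Sum>i\<in>UNIV. x $ i * x $ i)"
    by (intro real_polynomial_function_sum real_polynomial_function.intros(1,4)) auto
  ultimately show ?thesis by simp
qed

lemma real_polynomial_function_laplacian:
  assumes "real_polynomial_function f"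
  shows "real_polynomial_function (laplacian f)"
  unfolding laplacian_def[abs_def]
  by (intro real_polynomial_function_sum real_polynomial_function_partial_deriv assms) auto

lemma real_polynomial_function_normal_deriv:
  assumes "real_polynomial_function f"
  shows "real_polynomial_function (normal_deriv f)"
  unfolding normal_deriv_def[abs_def]
  by (intro real_polynomial_function_sum real_polynomial_function.intros(1,4)
      real_polynomial_function_partial_deriv assms) auto

lemma normal_deriv_add:
  assumes "real_polynomial_function f" "real_polynomial_function g"
  shows "normal_deriv (\<lambda>x. f x + g x) x = normal_deriv f x + normal_deriv g x"
  by (simp add: normal_deriv_def partial_deriv_add[OF assms] distrib_left sum.distrib)

lemma normal_deriv_mult:
  assumes "real_polynomial_function f" "real_polynomial_function g"
  shows "normal_deriv (\<lambda>x. f x * g x) x = f x * normal_deriv g x + normal_deriv f x * g x"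
  by (simp add: normal_deriv_def partial_deriv_mult[OF assms] sum_distrib_left sum_distrib_right
      distrib_left sum.distrib mult_ac)

lemma normal_deriv_cmult:
  assumes "real_polynomial_function f"
  shows "normal_deriv (\<lambda>x. c * f x) x = c * normal_deriv f x"
  by (simp add: normal_deriv_def partial_deriv_cmult[OF assms] sum_distrib_left mult_ac)

lemma subspace_real_polynomial_function:
  "subspace {f :: 'a::real_normed_vector \<Rightarrow> real. real_polynomial_function f}"
  by (auto simp: subspace_def plus_fun_def scaleR_fun_def zero_fun_def
      intro!: real_polynomial_function.intros(2-))

section \<open>Homogeneous components and the scaling law\<close>

lemma polys_upto_mono: "m \<le> m' \<Longrightarrow> polys_upto m \<subseteq> polys_upto m'"
  unfolding polys_upto_def by (intro span_mono) auto

lemma homogeneous_polys_subset_polys_upto: "k \<le> m \<Longrightarrow> homogeneous_polys k \<subseteq> polys_upto m"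
  unfolding polys_upto_def homogeneous_polys_def by (intro span_mono) auto

lemma polys_upto_imp_real_polynomial_function: "f \<in> polys_upto m \<Longrightarrow> real_polynomial_function f"
  using real_polynomial_function_iff_polys_upto by blast

lemma polys_upto_decompose:
  assumes "f \<in> polys_upto m"
  shows "\<exists>g. (\<forall>k. g k \<in> homogeneous_polys k) \<and> f = (\<Sum>k\<le>m. g k)"
  using assms unfolding polys_upto_def
proof (induction rule: span_induct_alt)
  case base
  have "\<forall>k. 0 \<in> homogeneous_polys k" by (simp add: homogeneous_polys_def span_zero)
  then show ?case by (intro exI[of _ "\<lambda>_. 0"] conjI) (simp_all only: sum.neutral_const)
next
  case (step c u f)
  then obtain a g where a: "u = monomial a" "(\<Sum>i\<in>UNIV. a i) \<le> m"
    and g: "\<forall>k. g k \<in> homogeneous_polys k" "f = (\<Sum>k\<le>m. g k)" by auto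
  define k0 where "k0 = (\<Sum>i\<in>UNIV. a i)"
  have "u \<in> homogeneous_polys k0"
    unfolding a homogeneous_polys_def k0_def by (intro span_base) auto
  then have "\<forall>k. g k + (if k = k0 then c *\<^sub>R u else 0) \<in> homogeneous_polys k"
    using g(1) unfolding homogeneous_polys_def by (auto intro: span_add span_scale)
  moreover have "c *\<^sub>R u + f = (\<Sum>k\<le>m. g k + (if k = k0 then c *\<^sub>R u else 0))"
    using a(2) by (simp add: sum.distrib g(2) add.commute k0_def)
  ultimately show ?case by (intro exI[of _ "\<lambda>k. g k + (if k = k0 then c *\<^sub>R u else 0)"]) blast
qed

lemma homogeneous_polys_scaleR:
  assumes "f \<in> homogeneous_polys k"
  shows "f (t *\<^sub>R x) = t ^ k * f x"
  using assms unfolding homogeneous_polys_def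
proof (induction rule: span_induct_alt)
  case (step c u f)
  then obtain a where "u = monomial a" "(\<Sum>i\<in>UNIV. a i) = k" by auto
  then have "u (t *\<^sub>R x) = t ^ k * u x"
    by (auto simp: monomial_def power_mult_distrib prod.distrib power_sum)
  then show ?case using step by (simp add: scaleR_fun_def plus_fun_def algebra_simps)
qed (simp add: zero_fun_def)

text \<open>With this description closure under products and derivatives is a check of a scaling
  law, without monomials. For the converse, f(tx) is expanded in homogeneous components and compared
  with t^k f(x) as a polynomial in t, for each fixed x.\<close>

lemma homogeneous_polys_iff:
  "f \<in> homogeneous_polys k \<longleftrightarrow> real_polynomial_function f \<and> (\<forall>t x. f (t *\<^sub>R x) = t ^ k * f x)"
proof
  assume "f \<in> homogeneous_polys k"
  then show "real_polynomial_function f \<and> (\<forall>t x. f (t *\<^sub>R x) = t ^ k * f x)"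
    using homogeneous_polys_scaleR homogeneous_polys_subset_polys_upto[of k k]
      polys_upto_imp_real_polynomial_function by blast
next
  assume f: "real_polynomial_function f \<and> (\<forall>t x. f (t *\<^sub>R x) = t ^ k * f x)"
  then obtain m0 where "f \<in> polys_upto m0" using real_polynomial_function_iff_polys_upto by blast
  \<comment> \<open>The bound is raised to at least \<open>k\<close> so that the component of degree
    \<open>k\<close> occurs in the sum.\<close>
  define m where "m = max m0 k"
  have "f \<in> polys_upto m" using \<open>f \<in> polys_upto m0\<close> polys_upto_mono[of m0 m] by (auto simp: m_def)
  then obtain g where g: "\<forall>k. g k \<in> homogeneous_polys k" "f = (\<Sum>k\<le>m. g k)"
    using polys_upto_decompose by blast
  have km: "k \<le> m" by (simp add: m_def)
  have "f x = g k x" for x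
  proof -
    have "(\<Sum>i\<le>m. g i x * t ^ i) = (\<Sum>i\<le>m. (if i = k then f x else 0) * t ^ i)" for t
    proof -
      have "(\<Sum>i\<le>m. g i x * t ^ i) = f (t *\<^sub>R x)"
        unfolding g(2) sum_fun_apply
        by (intro sum.cong refl) (metis g(1) homogeneous_polys_scaleR mult.commute)
      also have "\<dots> = t ^ k * f x" using f by simp
      also have "\<dots> = (\<Sum>i\<le>m. if i = k then t ^ k * f x else 0)" using km by simp
      also have "\<dots> = (\<Sum>i\<le>m. (if i = k then f x else 0) * t ^ i)" by (intro sum.cong) auto
      finally show ?thesis .
    qed
    then have "\<forall>i\<le>m. g i x = (if i = k then f x else 0)"
      using polyfun_eq_coeffs[of "\<lambda>i. g i x" m "\<lambda>i. if i = k then f x else 0"] by blast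
    then show ?thesis using km by simp
  qed
  then have "f = g k" by auto
  then show "f \<in> homogeneous_polys k" using g by simp
qed

lemma homogeneous_polys_imp_real_polynomial_function:
  "f \<in> homogeneous_polys k \<Longrightarrow> real_polynomial_function f"
  by (simp add: homogeneous_polys_iff)

lemma homogeneous_polys_mult:
  "\<lbrakk>f \<in> homogeneous_polys k; g \<in> homogeneous_polys l\<rbrakk> \<Longrightarrow> (\<lambda>x. f x * g x) \<in> homogeneous_polys (k + l)"
  by (auto simp: homogeneous_polys_iff power_add intro: real_polynomial_function.intros)

lemma homogeneous_polys_power_norm:
  "(\<lambda>x :: real ^ 'n::finite. (norm x)\<^sup>2) \<in> homogeneous_polys 2"
  by (auto simp: homogeneous_polys_iff real_polynomial_function_power_norm power_mult_distrib)

lemma subspace_homogeneous_polys: "subspace (homogeneous_polys k)"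
  by (simp add: homogeneous_polys_def)

text \<open>Exponent vectors of total degree k take values in {0..k}, so there are finitely many.
  Orthogonal projection is available only onto the span of a finite set.\<close>

lemma homogeneous_polys_finite_span:
  "\<exists>S. finite S \<and> (homogeneous_polys k :: (real ^ 'n::finite \<Rightarrow> real) set) = span S"
proof -
  have "{a :: 'n \<Rightarrow> nat. (\<Sum>i\<in>UNIV. a i) = k} \<subseteq> (UNIV :: 'n set) \<rightarrow>\<^sub>E {..k}"
    by (auto simp: PiE_def intro: member_le_sum)
  then have "finite {a :: 'n \<Rightarrow> nat. (\<Sum>i\<in>UNIV. a i) = k}"
    by (rule finite_subset) (intro finite_PiE, auto)
  then have "finite (monomial ` {a :: 'n \<Rightarrow> nat. (\<Sum>i\<in>UNIV. a i) = k})" by simp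
  moreover have "monomial ` {a :: 'n \<Rightarrow> nat. (\<Sum>i\<in>UNIV. a i) = k} = {monomial a |a. (\<Sum>i\<in>UNIV. a i) = k}"
    by auto
  ultimately show ?thesis unfolding homogeneous_polys_def by metis
qed

text \<open>Differentiating f(tx) = t^k f(x) in x in two ways. The factor \<open>t\<close> stays on
  the left, so that the identity also covers t = 0 and k = 0.\<close>

lemma frechet_derivative_homogeneous:
  fixes f :: "real ^ 'n::finite \<Rightarrow> real"
  assumes "f \<in> homogeneous_polys k"
  shows "t * frechet_derivative f (at (t *\<^sub>R x)) v = t ^ k * frechet_derivative f (at x) v"
proof -
  have rp: "real_polynomial_function f" using assms by (simp add: homogeneous_polys_iff)
  have lin: "linear (frechet_derivative f (at (t *\<^sub>R x)))"
    using real_polynomial_has_derivative[OF rp] has_derivative_linear by blast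
  have "((\<lambda>x. f (t *\<^sub>R x)) has_derivative (\<lambda>v. frechet_derivative f (at (t *\<^sub>R x)) (t *\<^sub>R v))) (at x)"
    by (rule has_derivative_compose[OF has_derivative_scaleR_right[OF has_derivative_ident]
          real_polynomial_has_derivative[OF rp]])
  moreover have "((\<lambda>x. f (t *\<^sub>R x)) has_derivative (\<lambda>v. t ^ k * frechet_derivative f (at x) v)) (at x)"
    using has_derivative_mult_right[OF real_polynomial_has_derivative[OF rp], of "t ^ k" x]
    unfolding homogeneous_polys_scaleR[OF assms] by simp
  ultimately have "frechet_derivative f (at (t *\<^sub>R x)) (t *\<^sub>R v) = t ^ k * frechet_derivative f (at x) v"
    using has_derivative_unique by metis
  then show ?thesis using lin by (simp add: linear_scale)
qed

lemma partial_deriv_homogeneous_0: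
  fixes f :: "real ^ 'n::finite \<Rightarrow> real"
  assumes "f \<in> homogeneous_polys 0"
  shows "partial_deriv i f = 0"
  using frechet_derivative_homogeneous[OF assms, of 0] by (auto simp: partial_deriv_def zero_fun_def)

text \<open>For k = 0 the truncated degree k - 1 is 0, which is harmless because the derivative is
  the zero polynomial. For k > 0 the scaling law comes from cancelling a factor t.\<close>

lemma partial_deriv_homogeneous:
  fixes f :: "real ^ 'n::finite \<Rightarrow> real"
  assumes f: "f \<in> homogeneous_polys k"
  shows "partial_deriv i f \<in> homogeneous_polys (k - 1)"
proof (cases "k = 0")
  case True
  then show ?thesis
    using partial_deriv_homogeneous_0 f subspace_0[OF subspace_homogeneous_polys] by metis
next
  case False
  then obtain l where l: "k = Suc l" by (cases k) auto
  have rp: "real_polynomial_function (partial_deriv i f)"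
    using f by (simp add: homogeneous_polys_iff real_polynomial_function_partial_deriv)
  have nz: "partial_deriv i f (t *\<^sub>R x) = t ^ l * partial_deriv i f x" if "t \<noteq> 0" for t x
    using frechet_derivative_homogeneous[OF f, of t x "axis i 1"] that
    by (simp add: partial_deriv_def l)
  \<comment> \<open>Cancelling t is impossible at t = 0; there the law follows by continuity in
    t.\<close>
  have "partial_deriv i f (0 *\<^sub>R x) = 0 ^ l * partial_deriv i f x" for x
  proof -
    let ?g = "\<lambda>t. partial_deriv i f (t *\<^sub>R x) - t ^ l * partial_deriv i f x"
    have "isCont ?g 0"
      using differentiable_imp_continuous_within[OF differentiable_at_real_polynomial_function[OF rp]]
      by (intro continuous_intros isCont_o2[where f = "\<lambda>t. t *\<^sub>R x"])
    then have "?g \<midarrow>0\<rightarrow> ?g 0" by (simp add: isCont_def)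
    moreover have "?g \<midarrow>0\<rightarrow> 0"
      by (rule tendsto_eventually) (auto simp: eventually_at_filter nz)
    ultimately have "?g 0 = 0" using LIM_unique by blast
    then show ?thesis by simp
  qed
  then have "partial_deriv i f (t *\<^sub>R x) = t ^ l * partial_deriv i f x" for t x
    using nz by (cases "t = 0") auto
  then show ?thesis using rp by (simp add: homogeneous_polys_iff l)
qed

lemma laplacian_homogeneous:
  fixes f :: "real ^ 'n::finite \<Rightarrow> real"
  assumes f: "f \<in> homogeneous_polys k"
  shows "laplacian f \<in> homogeneous_polys (k - 2)"
proof -
  have "partial_deriv i (partial_deriv i f) \<in> homogeneous_polys (k - 2)" for i
    using partial_deriv_homogeneous[OF partial_deriv_homogeneous[OF f], of i i]
    by (simp add: numeral_2_eq_2)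
  then have "(\<Sum>i\<in>UNIV. partial_deriv i (partial_deriv i f)) \<in> homogeneous_polys (k - 2)"
    by (intro subspace_sum subspace_homogeneous_polys) auto
  also have "(\<Sum>i\<in>UNIV. partial_deriv i (partial_deriv i f)) = laplacian f"
    by (auto simp: sum_fun_apply laplacian_def)
  finally show ?thesis .
qed

lemma laplacian_homogeneous_less_2:
  fixes f :: "real ^ 'n::finite \<Rightarrow> real"
  assumes f: "f \<in> homogeneous_polys k" and "k < 2"
  shows "laplacian f x = 0"
proof -
  have "partial_deriv i f \<in> homogeneous_polys 0" for i
    using partial_deriv_homogeneous[OF f, of i] \<open>k < 2\<close> by (cases k) auto
  then have "partial_deriv i (partial_deriv i f) = 0" for i by (rule partial_deriv_homogeneous_0)
  then show ?thesis by (simp add: laplacian_def)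
qed

text \<open>Euler's identity, from differentiating f(tx) = t^k f(x) in t at t = 1.\<close>

lemma normal_deriv_homogeneous:
  fixes f :: "real ^ 'n::finite \<Rightarrow> real"
  assumes f: "f \<in> homogeneous_polys k"
  shows "normal_deriv f x = real k * f x"
proof -
  have rp: "real_polynomial_function f" using f by (simp add: homogeneous_polys_iff)
  have "((\<lambda>t. f (t *\<^sub>R x)) has_derivative (\<lambda>h. frechet_derivative f (at (1 *\<^sub>R x)) (h *\<^sub>R x))) (at 1)"
    by (rule has_derivative_compose[OF has_derivative_scaleR_left[OF has_derivative_ident]
          real_polynomial_has_derivative[OF rp]])
  moreover have "((\<lambda>t. f (t *\<^sub>R x)) has_derivative (\<lambda>h. real k * h * f x)) (at (1::real))"
    unfolding homogeneous_polys_scaleR[OF f] by (auto intro!: derivative_eq_intros)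
  ultimately have "(\<lambda>h. frechet_derivative f (at (1 *\<^sub>R x)) (h *\<^sub>R x)) = (\<lambda>h. real k * h * f x)"
    by (rule has_derivative_unique)
  from fun_cong[OF this, of 1] have "frechet_derivative f (at x) x = real k * f x"
    by (simp only: scaleR_one mult_1_right)
  then show ?thesis by (simp only: normal_deriv_eq_frechet[OF rp])
qed

section \<open>Integration in polar coordinates\<close>


text \<open>The integrand is constant along rays, so a dilation contributes only its
  Jacobian.\<close>

lemma nn_integral_cball_scale:
  fixes H :: "'a::euclidean_space \<Rightarrow> ennreal"
  assumes [measurable]: "H \<in> borel_measurable borel" and \<rho>: "\<rho> > 0"
  shows "(\<integral>\<^sup>+x\<in>cball 0 \<rho>. H (sgn x) \<partial>lborel) =
           ennreal (\<rho> ^ DIM('a)) * (\<integral>\<^sup>+x\<in>cball 0 1. H (sgn x) \<partial>lborel)"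
proof -
  have [measurable]: "cball 0 r \<in> sets (borel :: 'a measure)" for r by simp
  have "(\<integral>\<^sup>+x\<in>cball 0 \<rho>. H (sgn x) \<partial>lborel) =
     (\<integral>\<^sup>+x. H (sgn x) * indicator (cball 0 \<rho>) x
        \<partial>density (distr lborel borel (\<lambda>x::'a. 0 + \<rho> *\<^sub>R x)) (\<lambda>_. \<bar>\<rho>\<bar> ^ DIM('a)))"
    using lborel_affine[of \<rho> "0::'a"] \<rho> by simp
  also have "\<dots> = (\<integral>\<^sup>+x. ennreal (\<rho> ^ DIM('a)) *
       (H (sgn (\<rho> *\<^sub>R x)) * indicator (cball 0 \<rho>) (\<rho> *\<^sub>R x)) \<partial>lborel)"
    using \<rho> by (subst nn_integral_density, measurable) (subst nn_integral_distr, simp_all, measurable)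
  also have "\<dots> = (\<integral>\<^sup>+x. ennreal (\<rho> ^ DIM('a)) * (H (sgn x) * indicator (cball 0 1) x) \<partial>lborel)"
    using \<rho> by (intro nn_integral_cong) (simp add: sgn_scaleR indicator_def)
  also have "\<dots> = ennreal (\<rho> ^ DIM('a)) * (\<integral>\<^sup>+x\<in>cball 0 1. H (sgn x) \<partial>lborel)"
    by (intro nn_integral_cmult) auto
  finally show ?thesis .
qed

text \<open>Distribution functions are compared on \<open>{..x}\<close> because the preimage of such
  a set under |x|^2 is a closed ball, or all of the domain, or null. Finite total mass permits
  passing to complements.\<close>

lemma measure_eqI_atMost:
  fixes M N :: "real measure"
  assumes sets: "sets M = sets borel" "sets N = sets borel"
    and fin: "emeasure M UNIV < \<infinity>" and UNIV: "emeasure M UNIV = emeasure N UNIV"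
    and eq: "\<And>x. emeasure M {..x} = emeasure N {..x}"
  shows "M = N"
proof (rule measure_eqI_lessThan[OF sets])
  have sp: "space M = UNIV" "space N = UNIV"
    using sets_eq_imp_space_eq[OF sets(1)] sets_eq_imp_space_eq[OF sets(2)] by auto
  have fin': "emeasure M A < \<infinity>" for A
    using emeasure_space[of M A] fin sp by (metis order_le_less_trans)
  show "emeasure M {x<..} < \<infinity>" for x by (rule fin')
  show "emeasure M {x<..} = emeasure N {x<..}" for x
  proof -
    have "{x<..} = UNIV - {..x}" by auto
    then show ?thesis
      using emeasure_Diff[of M "{..x}" UNIV] emeasure_Diff[of N "{..x}" UNIV] fin'[of "{..x}"] eq[of x]
      by (simp add: sets UNIV)
  qed
qed

text \<open>Both sides have distribution function K v^(d/2) on [0,1]: on the left the ball of radius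
  sqrt v carries the mass (sqrt v)^d K, on the right the density is the derivative of that power.
  Nonnegativity makes H(sgn x) a density.\<close>

lemma distr_norm_power2_cball:
  fixes H :: "'a::euclidean_space \<Rightarrow> real"
  assumes H [measurable]: "H \<in> borel_measurable borel" and nonneg: "\<And>x. 0 \<le> H (sgn x)"
    and int: "set_integrable lborel (cball 0 1) (\<lambda>x. H (sgn x))"
  defines "K \<equiv> (LBINT x:cball 0 1. H (sgn x))"
  shows "distr (density lborel (\<lambda>x. ennreal (indicator (cball 0 1) x * H (sgn x)))) borel (\<lambda>x. (norm x)\<^sup>2) =
    density lborel (\<lambda>v. ennreal (indicator {0..1} v * (K * (real DIM('a) / 2) * v powr (real DIM('a) / 2 - 1))))"
    (is "?M = ?N")
proof -
  let ?D = "real DIM('a)"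
  have D: "?D > 0" by simp
  have K: "(\<integral>\<^sup>+x\<in>cball 0 1. ennreal (H (sgn x)) \<partial>lborel) = ennreal K"
  proof -
    have "(\<integral>\<^sup>+x\<in>cball 0 1. ennreal (H (sgn x)) \<partial>lborel) =
          (\<integral>\<^sup>+x. ennreal (indicator (cball 0 1) x *\<^sub>R H (sgn x)) \<partial>lborel)"
      by (intro nn_integral_cong) (auto simp: indicator_def)
    also have "\<dots> = ennreal K"
      unfolding K_def set_lebesgue_integral_def
      by (rule nn_integral_eq_integral) (use int nonneg in \<open>auto simp: set_integrable_def\<close>)
    finally show ?thesis .
  qed
  have K0: "K \<ge> 0" unfolding K_def set_lebesgue_integral_def by (intro Bochner_Integration.integral_nonneg) (simp add: nonneg)
  have M: "emeasure ?M A = (\<integral>\<^sup>+x. ennreal (H (sgn x)) * indicator {x \<in> cball 0 1. (norm x)\<^sup>2 \<in> A} x \<partial>lborel)"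
    if [measurable]: "A \<in> sets borel" for A
  proof -
    have [measurable]: "cball 0 1 \<in> sets (borel :: 'a measure)" by simp
    have [measurable]: "(\<lambda>x::'a. (norm x)\<^sup>2) -` A \<in> sets borel"
      by (rule measurable_sets_borel[OF _ that]) simp
    have "emeasure ?M A = (\<integral>\<^sup>+x. ennreal (indicator (cball 0 1) x * H (sgn x)) *
        indicator ((\<lambda>x. (norm x)\<^sup>2) -` A) x \<partial>lborel)"
      by (simp add: emeasure_distr emeasure_density)
    then show ?thesis
      by (subst \<open>emeasure ?M A = _\<close>) (intro nn_integral_cong, auto simp: indicator_def)
  qed
  have powr_int: "(\<integral>\<^sup>+v\<in>{0..s}. ennreal (v powr (?D / 2 - 1)) \<partial>lborel) = ennreal (s powr (?D / 2) / (?D / 2))"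
    if "s \<ge> 0" for s
  proof -
    have "((\<lambda>v. v powr (?D / 2 - 1)) has_integral (s powr (?D / 2) / (?D / 2))) {0..s}"
      using has_integral_powr_from_0[of "?D / 2 - 1" s] that D by simp
    then have "((\<lambda>v. if v \<in> {0..s} then v powr (?D / 2 - 1) else 0) has_integral (s powr (?D / 2) / (?D / 2))) UNIV"
      by (subst has_integral_restrict_UNIV)
    then have "(\<integral>\<^sup>+v. ennreal (if v \<in> {0..s} then v powr (?D / 2 - 1) else 0) \<partial>lborel) = ennreal (s powr (?D / 2) / (?D / 2))"
      by (intro nn_integral_has_integral_lborel) auto
    also have "(\<integral>\<^sup>+v. ennreal (if v \<in> {0..s} then v powr (?D / 2 - 1) else 0) \<partial>lborel) =
        (\<integral>\<^sup>+v\<in>{0..s}. ennreal (v powr (?D / 2 - 1)) \<partial>lborel)"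
      by (intro nn_integral_cong) (auto simp: indicator_def)
    finally show ?thesis .
  qed
  have N: "emeasure ?N A = ennreal (K * (s powr (?D / 2)))"
    if [measurable]: "A \<in> sets borel" and A: "A \<inter> {0..1} = {0..s}" "s \<ge> 0" for A s
  proof -
    have "emeasure ?N A = (\<integral>\<^sup>+v. ennreal (K * (?D / 2)) * (ennreal (v powr (?D / 2 - 1)) * indicator {0..s} v) \<partial>lborel)"
    proof -
      have "ennreal (indicator {0..1} v * (K * (?D / 2) * v powr (?D / 2 - 1))) * indicator A v =
          ennreal (K * (?D / 2)) * (ennreal (v powr (?D / 2 - 1)) * indicator {0..s} v)" for v
      proof (cases "v \<in> {0..s}")
        case True
        then have "v \<in> A" "v \<in> {0..1}" using A(1) by blast+
        then show ?thesis using True K0 by (simp flip: ennreal_mult)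
      next
        case False
        then have "v \<notin> A \<or> v \<notin> {0..1}" using A(1) by blast
        then show ?thesis using False by auto
      qed
      then show ?thesis by (subst emeasure_density) simp_all
    qed
    also have "\<dots> = ennreal (K * (?D / 2)) * ennreal (s powr (?D / 2) / (?D / 2))"
      by (subst nn_integral_cmult) (simp_all add: powr_int[OF A(2)])
    also have "\<dots> = ennreal (K * (s powr (?D / 2)))"
      using K0 by (simp flip: ennreal_mult')
    finally show ?thesis .
  qed
  have MK: "emeasure ?M A = ennreal K" if A: "A \<in> sets borel" "{0..1} \<subseteq> A" for A
  proof -
    have "{x \<in> cball (0::'a) 1. (norm x)\<^sup>2 \<in> A} = cball 0 1"
      using A(2) by (auto simp: subset_iff power_le_one)
    then show ?thesis using M[OF A(1)] K by simp
  qed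
  show ?thesis
  proof (rule measure_eqI_atMost)
    show "emeasure ?M UNIV < \<infinity>" using MK[of UNIV] by simp
    show "emeasure ?M UNIV = emeasure ?N UNIV" using MK[of UNIV] N[of UNIV 1] by simp
    show "emeasure ?M {..v} = emeasure ?N {..v}" for v
    proof -
      consider "v \<le> 0" | "0 < v" "v < 1" | "1 \<le> v" by linarith
      then show ?thesis
      proof cases
        case 1
        \<comment> \<open>For v <= 0 the preimage of \<open>{..v}\<close> contains at most the
          origin, a null set.\<close>
        have "AE x in lborel. x \<noteq> (0::'a)" by (rule AE_lborel_singleton)
        then have "AE x in lborel. ennreal (H (sgn x)) * indicator {x \<in> cball 0 1. (norm x)\<^sup>2 \<in> {..v}} x = 0"
        proof eventually_elim
          case (elim x)
          then have "(norm x)\<^sup>2 > 0" by simp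
          then have "\<not> (norm x)\<^sup>2 \<le> v" using 1 by linarith
          then show ?case by simp
        qed
        then have "emeasure ?M {..v} = (\<integral>\<^sup>+x. 0 \<partial>(lborel::'a measure))"
          by (subst M, simp) (rule nn_integral_cong_AE)
        moreover have "emeasure ?N {..v} = (\<integral>\<^sup>+x. 0 \<partial>(lborel::real measure))"
        proof -
          \<comment> \<open>At w = 0 the density vanishes by the convention that
            \<open>0 powr y\<close> is 0.\<close>
          have "ennreal (indicator {0..1} w * (K * (?D / 2) * w powr (?D / 2 - 1))) * indicator {..v} w = 0" for w
            using 1 by (cases "w = 0") (auto simp: indicator_def)
          then show ?thesis by (subst emeasure_density) (simp_all only:, simp_all)
        qed
        ultimately show ?thesis by simp
      next
        case 2
        have ball: "{x \<in> cball (0::'a) 1. (norm x)\<^sup>2 \<in> {..v}} = cball 0 (sqrt v)"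
        proof -
          have *: "(norm x)\<^sup>2 \<le> v \<longleftrightarrow> norm x \<le> sqrt v" for x :: 'a
            using 2 real_le_rsqrt[of "norm x" v] sqrt_ge_absD[of "norm x" v] by auto
          have **: "sqrt v \<le> 1" using 2 by simp
          have "norm x \<le> 1 \<and> norm x \<le> sqrt v \<longleftrightarrow> norm x \<le> sqrt v" for x :: 'a
            using ** by linarith
          then show ?thesis by (simp add: * cball_def)
        qed
        have "emeasure ?M {..v} = (\<integral>\<^sup>+x\<in>cball 0 (sqrt v). ennreal (H (sgn x)) \<partial>lborel)"
          by (subst M, simp) (simp only: ball)
        also have "\<dots> = ennreal (sqrt v ^ DIM('a)) * ennreal K"
          using 2 by (subst nn_integral_cball_scale) (simp_all only: K, simp_all)
        also have "sqrt v ^ DIM('a) = v powr (?D / 2)"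
        proof -
          have "sqrt v ^ DIM('a) = (v powr (1/2)) powr ?D"
            using 2 by (simp add: powr_half_sqrt powr_realpow)
          then show ?thesis by (simp add: powr_powr)
        qed
        also have "ennreal (v powr (?D / 2)) * ennreal K = emeasure ?N {..v}"
        proof -
          have "{..v} \<inter> {0..1} = {0..v}" using 2 by auto
          then have "emeasure ?N {..v} = ennreal (K * (v powr (?D / 2)))"
            using 2 by (intro N) auto
          also have "\<dots> = ennreal (v powr (?D / 2)) * ennreal K"
            using K0 by (subst ennreal_mult) (auto simp: mult.commute)
          finally show ?thesis by simp
        qed
        finally show ?thesis .
      next
        case 3
        then have "{..v} \<inter> {0..1} = {0..1}" by auto
        then show ?thesis using 3 MK[of "{..v}"] N[of "{..v}" 1] by simp
      qed
    qed
  qed auto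
qed

section \<open>Integrals against the surface measure\<close>

lemma sphere_measure_eq_density:
  "(sphere_measure :: (real ^ 'n::finite) measure) = density
     (distr (restrict_space lborel (cball 0 1 - {0})) (restrict_space borel (sphere 0 1)) sgn)
     (\<lambda>_. ennreal (real CARD('n)))"
  unfolding sphere_measure_def by (rule measure_eqI) (simp_all add: emeasure_density_const ennreal_of_nat_eq_real_of_nat)

lemma measurable_sgn_sphere:
  "sgn \<in> measurable (restrict_space lborel (cball (0::'a::euclidean_space) 1 - {0})) (restrict_space borel (sphere 0 1))"
proof (rule measurable_restrict_space2)
  show "sgn \<in> space (restrict_space lborel (cball (0::'a) 1 - {0})) \<rightarrow> sphere 0 1"
    by (auto simp: space_restrict_space norm_sgn)
  show "sgn \<in> borel_measurable (restrict_space lborel (cball (0::'a) 1 - {0}))"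
    by (rule measurable_restrict_space1) simp
qed

lemma
  fixes f :: "real ^ 'n::finite \<Rightarrow> real"
  assumes [measurable]: "f \<in> borel_measurable borel"
  shows integral_sphere_measure:
      "(LINT x|sphere_measure. f x) = real CARD('n) * (LBINT x:cball 0 1. f (sgn x))"
    and integrable_sphere_measure_iff:
      "integrable sphere_measure f \<longleftrightarrow> set_integrable lborel (cball 0 1) (\<lambda>x. f (sgn x))"
proof -
  have [measurable]: "f \<in> borel_measurable (restrict_space borel (sphere 0 1))"
    by (rule measurable_restrict_space1) simp
  have f [measurable]: "f \<in> borel_measurable (distr (restrict_space lborel (cball 0 1 - {0})) (restrict_space borel (sphere 0 1)) sgn)"
    by simp
  have [measurable]: "cball 0 1 \<in> sets (borel :: (real^'n) measure)" by simp
  \<comment> \<open>The cone construction omits the origin, where \<open>sgn\<close> leaves the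
    sphere; a single point does not affect the integral.\<close>
  have AE: "AE x in lborel. indicator (cball 0 1 - {0}) x *\<^sub>R f (sgn x) = indicator (cball 0 1) x *\<^sub>R f (sgn x)"
    using AE_lborel_singleton[of "0::real^'n"] by eventually_elim (simp add: indicator_def)
  have "(LINT x|sphere_measure. f x) = real CARD('n) *
      (LINT x|lborel. indicator (cball 0 1 - {0}) x *\<^sub>R f (sgn x))"
    unfolding sphere_measure_eq_density
    by (subst integral_density) (simp_all add: integral_distr[OF measurable_sgn_sphere] integral_restrict_space)
  also have "(LINT x|lborel. indicator (cball 0 1 - {0}) x *\<^sub>R f (sgn x)) = (LBINT x:cball 0 1. f (sgn x))"
    unfolding set_lebesgue_integral_def by (intro integral_cong_AE AE) auto
  finally show "(LINT x|sphere_measure. f x) = real CARD('n) * (LBINT x:cball 0 1. f (sgn x))" .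
  have "integrable sphere_measure f \<longleftrightarrow>
      integrable lborel (\<lambda>x. indicator (cball 0 1 - {0}) x *\<^sub>R f (sgn x))"
    unfolding sphere_measure_eq_density
    by (subst integrable_density) (simp_all add: integrable_distr_eq[OF measurable_sgn_sphere] integrable_restrict_space)
  also have "\<dots> \<longleftrightarrow> set_integrable lborel (cball 0 1) (\<lambda>x. f (sgn x))"
    unfolding set_integrable_def by (intro integrable_cong_AE AE) auto
  finally show "integrable sphere_measure f \<longleftrightarrow> set_integrable lborel (cball 0 1) (\<lambda>x. f (sgn x))" .
qed

lemma continuous_comp_sgn_bounded:
  fixes H :: "'a::euclidean_space \<Rightarrow> real"
  assumes "continuous_on UNIV H"
  shows "\<exists>C. \<forall>x. \<bar>H (sgn x)\<bar> \<le> C"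
proof -
  have "compact (H ` cball 0 1)"
    using assms by (intro compact_continuous_image) (auto intro: continuous_on_subset)
  then obtain C where "\<forall>y \<in> H ` cball 0 1. norm y \<le> C"
    using compact_imp_bounded bounded_iff by blast
  moreover have "sgn x \<in> cball 0 1" for x :: 'a by (simp add: norm_sgn)
  ultimately have "\<bar>H (sgn x)\<bar> \<le> C" for x by simp
  then show ?thesis by blast
qed

lemma set_integrable_bounded_cball:
  fixes f :: "'a::euclidean_space \<Rightarrow> real"
  assumes [measurable]: "f \<in> borel_measurable borel" and "\<And>x. x \<in> cball 0 1 \<Longrightarrow> \<bar>f x\<bar> \<le> C"
  shows "set_integrable lborel (cball 0 1) f"
  unfolding set_integrable_def
proof (rule integrableI_bounded_set_indicator[where B = C])
  show "emeasure lborel (cball (0::'a) 1) < \<infinity>" by (simp add: emeasure_cball)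
qed (use assms in auto)

text \<open>Polar coordinates in the variable v = r^2, where r^(d-1) dr = v^(d/2-1) dv / 2; this is
  the origin of the factor 1/2. For nonnegative \<open>H\<close> it is the image measure identity
  integrated against \<open>G\<close>.\<close>

lemma radial_spherical_integral:
  fixes H :: "real ^ 'n::finite \<Rightarrow> real"
  assumes H: "continuous_on UNIV H" and G [measurable]: "G \<in> borel_measurable borel"
    and G_int: "set_integrable lborel {0..1} (\<lambda>v. G v * v powr (real CARD('n) / 2 - 1))"
  shows "set_integrable lborel (cball 0 1) (\<lambda>x. G ((norm x)\<^sup>2) * H (sgn x))" (is "?I H")
    and "(LBINT x:cball 0 1. G ((norm x)\<^sup>2) * H (sgn x)) =
      (LBINT v:{0..1}. G v * v powr (real CARD('n) / 2 - 1)) * (LINT x|sphere_measure. H x) / 2" (is "?E H")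
proof -
  have nonneg: "?I H \<and> ?E H" if H: "continuous_on UNIV H" and pos: "\<And>x. 0 \<le> H (sgn x)" for H :: "real^'n \<Rightarrow> real"
  proof -
    have [measurable]: "H \<in> borel_measurable borel" using H by (rule borel_measurable_continuous_onI)
    have [measurable]: "cball 0 1 \<in> sets (borel :: (real^'n) measure)" by simp
    define K where "K = (LBINT x:cball 0 1. H (sgn x))"
    obtain C where C: "\<And>x. \<bar>H (sgn x)\<bar> \<le> C" using continuous_comp_sgn_bounded[OF H] by blast
    have K0: "K \<ge> 0" unfolding K_def set_lebesgue_integral_def
      by (intro Bochner_Integration.integral_nonneg) (simp add: pos)
    have eq: "distr (density lborel (\<lambda>x. ennreal (indicator (cball 0 1) x * H (sgn x)))) borel (\<lambda>x. (norm x)\<^sup>2) =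
      density lborel (\<lambda>v. ennreal (indicator {0..1} v * (K * (real CARD('n) / 2) * v powr (real CARD('n) / 2 - 1))))"
      (is "?M = ?N")
      using distr_norm_power2_cball[of H, OF _ pos set_integrable_bounded_cball[OF _ C]] by (simp add: K_def)
    have "integrable lborel (\<lambda>v. (K * (real CARD('n) / 2)) * (indicator {0..1} v *\<^sub>R (G v * v powr (real CARD('n) / 2 - 1))))"
      using G_int unfolding set_integrable_def by (rule integrable_mult_right)
    then have "integrable ?N G"
      using K0 by (subst integrable_density) (auto simp: mult_ac)
    then have "integrable ?M G" by (simp only: eq)
    then have 1: "?I H"
      unfolding set_integrable_def
      by (subst (asm) integrable_distr_eq, simp, simp, subst (asm) integrable_density) (auto simp: mult_ac pos)
    have "(LINT v|?M. G v) = (LBINT x:cball 0 1. G ((norm x)\<^sup>2) * H (sgn x))"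
      unfolding set_lebesgue_integral_def
      by (subst integral_distr, simp, simp, subst integral_density) (auto simp: mult_ac pos)
    moreover have "(LINT v|?N. G v) = (LINT v|lborel. (K * (real CARD('n) / 2)) * (indicator {0..1} v *\<^sub>R (G v * v powr (real CARD('n) / 2 - 1))))"
      using K0 by (subst integral_density) (auto simp: mult_ac)
    moreover have "\<dots> = (LBINT v:{0..1}. G v * v powr (real CARD('n) / 2 - 1)) * (LINT x|sphere_measure. H x) / 2"
      unfolding set_lebesgue_integral_def integral_mult_right_zero
      by (simp add: integral_sphere_measure K_def set_lebesgue_integral_def)
    ultimately show ?thesis using 1 eq by simp
  qed
  obtain C where C: "\<And>x. \<bar>H (sgn x)\<bar> \<le> C" using continuous_comp_sgn_bounded[OF H] by blast
  have C0: "C \<ge> 0" using C[of 0] by simp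
  have mH [measurable]: "H \<in> borel_measurable borel" using H by (rule borel_measurable_continuous_onI)
  \<comment> \<open>A signed \<open>H\<close> is written as the difference of \<open>H + C\<close>
    and the constant \<open>C\<close>, both nonnegative on the range of \<open>sgn\<close>.\<close>
  have pos: "0 \<le> H (sgn x) + C" for x using C[of x] by linarith
  have A: "?I (\<lambda>x. H x + C) \<and> ?E (\<lambda>x. H x + C)"
    by (rule nonneg) (use pos in \<open>auto intro!: continuous_intros H\<close>)
  have B: "?I (\<lambda>x. C) \<and> ?E (\<lambda>x. C)"
    by (rule nonneg) (use C0 in auto)
  have eq: "G ((norm x)\<^sup>2) * H (sgn x) = G ((norm x)\<^sup>2) * (H (sgn x) + C) - G ((norm x)\<^sup>2) * C" for x
    by (simp add: algebra_simps)
  show "?I H" unfolding eq using A B by (intro set_integral_diff) auto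
  have "integrable sphere_measure H" "integrable sphere_measure (\<lambda>x::real^'n. C)"
    using C C0 by (auto simp: integrable_sphere_measure_iff intro!: set_integrable_bounded_cball)
  then have "(LINT x|sphere_measure. H x) = (LINT x|sphere_measure. H x + C) - (LINT (x::real^'n)|sphere_measure. C)"
    by simp
  moreover have "(LBINT x:cball 0 1. G ((norm x)\<^sup>2) * H (sgn x)) =
     (LBINT x:cball 0 1. G ((norm x)\<^sup>2) * (H (sgn x) + C)) - (LBINT (x::real^'n):cball 0 1. G ((norm x)\<^sup>2) * C)"
    unfolding eq using A B by (intro set_integral_diff) auto
  ultimately show "?E H" using A B by (simp only:) (simp add: algebra_simps diff_divide_distrib)
qed

lemma continuous_on_real_polynomial_function:
  fixes f :: "'a::euclidean_space \<Rightarrow> real"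
  shows "real_polynomial_function f \<Longrightarrow> continuous_on S f"
  by (simp add: continuous_on_polymonial_function real_polynomial_function_eq)

lemma homogeneous_polys_eq_sgn:
  assumes "Z \<in> homogeneous_polys m"
  shows "Z x = norm x ^ m * Z (sgn x)"
proof (cases "x = 0")
  case False
  then have "norm x *\<^sub>R sgn x = x" by (simp add: sgn_div_norm)
  then show ?thesis using homogeneous_polys_scaleR[OF assms, of "norm x" "sgn x"] by simp
next
  case True
  then show ?thesis using homogeneous_polys_scaleR[OF assms, of "norm x" "x"] by simp
qed

text \<open>Homogeneity gives Z(x) = |x|^m Z(sgn x), and |x|^m = v^(m/2) is absorbed into the radial
  exponent.\<close>

lemma radial_homogeneous_integral:
  fixes Z :: "real ^ 'n::finite \<Rightarrow> real"
  assumes Z: "Z \<in> homogeneous_polys m" and G [measurable]: "G \<in> borel_measurable borel"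
    and G_int: "set_integrable lborel {0..1} (\<lambda>v. G v * v powr (real m / 2 + real CARD('n) / 2 - 1))"
  shows "set_integrable lborel (cball 0 1) (\<lambda>x. G ((norm x)\<^sup>2) * Z x)"
    and "(LBINT x:cball 0 1. G ((norm x)\<^sup>2) * Z x) =
      (LBINT v:{0..1}. G v * v powr (real m / 2 + real CARD('n) / 2 - 1)) * (LINT x|sphere_measure. Z x) / 2"
proof -
  have Zc: "continuous_on UNIV Z"
    using Z by (simp add: homogeneous_polys_imp_real_polynomial_function continuous_on_real_polynomial_function)
  have eq: "G v * sqrt v ^ m * v powr (real CARD('n) / 2 - 1) = G v * v powr (real m / 2 + real CARD('n) / 2 - 1)"
    if "v \<in> {0..1}" for v
  proof (cases "v = 0")
    case False
    then have "v > 0" using that by simp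
    then have "sqrt v ^ m = v powr (real m / 2)"
      using powr_realpow[of "sqrt v" m] powr_powr[of v "1/2" "real m"] by (simp add: powr_half_sqrt)
    then show ?thesis by (simp add: powr_add[symmetric] algebra_simps)
  qed simp
  have int: "set_integrable lborel {0..1} (\<lambda>v. G v * sqrt v ^ m * v powr (real CARD('n) / 2 - 1))"
    by (subst set_integrable_cong[OF refl refl eq]) (use G_int in auto)
  have eq': "G ((norm x)\<^sup>2) * Z x = G ((norm x)\<^sup>2) * sqrt ((norm x)\<^sup>2) ^ m * Z (sgn x)" for x
    using homogeneous_polys_eq_sgn[OF Z, of x] by simp
  have *: "(\<lambda>v. G v * sqrt v ^ m) \<in> borel_measurable borel" by measurable
  show "set_integrable lborel (cball 0 1) (\<lambda>x. G ((norm x)\<^sup>2) * Z x)"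
    unfolding eq' by (rule radial_spherical_integral(1)[OF Zc * int])
  have "(LBINT v:{0..1}. G v * sqrt v ^ m * v powr (real CARD('n) / 2 - 1)) =
      (LBINT v:{0..1}. G v * v powr (real m / 2 + real CARD('n) / 2 - 1))"
    by (intro set_lebesgue_integral_cong) (use eq in auto)
  then show "(LBINT x:cball 0 1. G ((norm x)\<^sup>2) * Z x) =
      (LBINT v:{0..1}. G v * v powr (real m / 2 + real CARD('n) / 2 - 1)) * (LINT x|sphere_measure. Z x) / 2"
    unfolding eq' using radial_spherical_integral(2)[OF Zc * int] by simp
qed

section \<open>Definiteness of the spherical inner product\<close>

lemma integrable_sphere_measure_continuous:
  fixes f :: "real ^ 'n::finite \<Rightarrow> real"
  assumes "continuous_on UNIV f"
  shows "integrable sphere_measure f"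
proof -
  have [measurable]: "f \<in> borel_measurable borel" using assms by (rule borel_measurable_continuous_onI)
  obtain C where "\<And>x. \<bar>f (sgn x)\<bar> \<le> C" using continuous_comp_sgn_bounded[OF assms] by blast
  then show ?thesis by (auto simp: integrable_sphere_measure_iff intro!: set_integrable_bounded_cball)
qed

lemma integral_sphere_measure_cong:
  fixes f g :: "real ^ 'n::finite \<Rightarrow> real"
  assumes "\<And>x. norm x = 1 \<Longrightarrow> f x = g x"
  shows "(LINT x|sphere_measure. f x) = (LINT x|sphere_measure. g x)"
  by (intro Bochner_Integration.integral_cong refl assms)
     (simp add: sphere_measure_def space_scale_measure space_restrict_space)

text \<open>The set where \<open>g\<close> is nonzero is open in \<open>S\<close> and null, hence
  empty.\<close>

lemma AE_zero_on_open_imp_zero: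
  fixes g :: "'a::euclidean_space \<Rightarrow> real"
  assumes AE: "AE x in lborel. x \<in> S \<longrightarrow> g x = 0" and S: "open S" and g: "continuous_on S g" and x: "x \<in> S"
  shows "g x = 0"
proof -
  have op: "open (S \<inter> g -` (-{0}))"
    using g S by (intro continuous_open_preimage) auto
  have "AE x in lborel. x \<notin> S \<inter> g -` (-{0})"
    using AE by eventually_elim auto
  then have "S \<inter> g -` (-{0}) \<in> null_sets lborel"
    using op by (subst AE_iff_null_sets) (auto intro: borel_open)
  then have "negligible (S \<inter> g -` (-{0}))"
    by (simp add: negligible_iff_null_sets null_sets_completionI)
  then have "S \<inter> g -` (-{0}) = {}"
    using op open_not_negligible by blast
  then show ?thesis using x by auto
qed

lemma integral_sphere_power2_eq_0:
  fixes f :: "real ^ 'n::finite \<Rightarrow> real"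
  assumes f: "continuous_on UNIV f" and 0: "(LINT x|sphere_measure. f x * f x) = 0" and x: "norm x = 1"
  shows "f x = 0"
proof -
  have [measurable]: "f \<in> borel_measurable borel" using f by (rule borel_measurable_continuous_onI)
  have c: "continuous_on UNIV (\<lambda>x. f x * f x)" using f by (intro continuous_intros)
  have "set_integrable lborel (cball 0 1) (\<lambda>x. f (sgn x) * f (sgn x))"
    using integrable_sphere_measure_continuous[OF c] by (simp add: integrable_sphere_measure_iff)
  moreover have "(LBINT x:cball 0 1. f (sgn x) * f (sgn x)) = 0"
    using 0 by (simp add: integral_sphere_measure)
  ultimately have "AE x in lborel. indicator (cball 0 1) x *\<^sub>R (f (sgn x) * f (sgn x)) = 0"
    unfolding set_integrable_def set_lebesgue_integral_def
    by (subst (asm) integral_nonneg_eq_0_iff_AE) auto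
  then have "AE x in lborel. x \<in> ball 0 1 - {0} \<longrightarrow> f (sgn x) = 0"
    by eventually_elim (auto simp: indicator_def)
  \<comment> \<open>The origin is removed because \<open>sgn\<close> is discontinuous there. A point
    x of the sphere is then reached through the interior point x/2, which has direction x.\<close>
  moreover have "open (ball (0::real^'n) 1 - {0})" by auto
  moreover have "continuous_on (ball (0::real^'n) 1 - {0}) (\<lambda>x. f (sgn x))"
    by (rule continuous_on_compose2[OF f]) (auto intro!: continuous_on_sgn continuous_on_id)
  moreover have "x /\<^sub>R 2 \<in> ball 0 1 - {0}" using x by auto
  ultimately have "f (sgn (x /\<^sub>R 2)) = 0" by (rule AE_zero_on_open_imp_zero)
  moreover have "sgn (x /\<^sub>R 2) = x" using x by (simp add: sgn_div_norm)
  ultimately show ?thesis by simp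
qed

lemma homogeneous_sphere_zero_imp_zero:
  fixes f :: "real ^ 'n::finite \<Rightarrow> real"
  assumes f: "f \<in> homogeneous_polys m" and 0: "(LINT x|sphere_measure. f x * f x) = 0"
  shows "f = 0"
proof -
  have c: "continuous_on UNIV f"
    using f by (simp add: homogeneous_polys_imp_real_polynomial_function continuous_on_real_polynomial_function)
  have nz: "f x = 0" if "x \<noteq> 0" for x
    using homogeneous_polys_eq_sgn[OF f, of x] integral_sphere_power2_eq_0[OF c 0, of "sgn x"] that
    by (simp add: norm_sgn)
  \<comment> \<open>The sphere determines f only away from the origin; at the origin continuity
    decides, which matters for constants.\<close>
  have "f 0 = 0"
    by (rule AE_zero_on_open_imp_zero[of UNIV f]) (use AE_lborel_singleton[of "0::real^'n"] nz c in \<open>auto elim: eventually_mono\<close>)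
  then have "f x = 0" for x using nz by (cases "x = 0") auto
  then show ?thesis by (auto simp: zero_fun_def)
qed

lemma sphere_area_pos: "sphere_area TYPE('n::finite) > 0"
proof -
  have "sphere_area TYPE('n) = measure sphere_measure (sphere (0::real^'n) 1)"
    by (simp add: sphere_area_def sphere_measure_def space_scale_measure space_restrict_space)
  then show ?thesis by (simp add: measure_sphere_measure Gamma_real_pos)
qed

section \<open>Spherical harmonics\<close>


text \<open>Squaring removes the kink of \<open>max 0 s\<close>: at 0 the difference quotient is
  bounded by |h|. It is applied to s = 1 - |x|^2, the cut-off at the unit sphere.\<close>

lemma DERIV_max_0_power2: "((\<lambda>s::real. (max 0 s)\<^sup>2) has_field_derivative 2 * max 0 s) (at s)"
proof -
  consider "s > 0" | "s < 0" | "s = 0" by linarith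
  then show ?thesis
  proof cases
    case 1
    have "((\<lambda>s::real. s\<^sup>2) has_field_derivative 2 * s) (at s)"
      by (auto intro!: derivative_eq_intros)
    then have "((\<lambda>s::real. (max 0 s)\<^sup>2) has_field_derivative 2 * s) (at s)"
      by (rule has_field_derivative_transform_within_open[of _ _ _ "{0<..}"]) (use 1 in auto)
    then show ?thesis using 1 by simp
  next
    case 2
    have "((\<lambda>s::real. 0) has_field_derivative 0) (at s)" by simp
    then have "((\<lambda>s::real. (max 0 s)\<^sup>2) has_field_derivative 0) (at s)"
      by (rule has_field_derivative_transform_within_open[of _ _ _ "{..<0}"]) (use 2 in auto)
    then show ?thesis using 2 by simp
  next
    case 3
    have "(\<lambda>h::real. (max 0 h)\<^sup>2 / h) \<midarrow>0\<rightarrow> 0"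
    proof (rule tendsto_0_le[where K = 1])
      show "(\<lambda>h::real. h) \<midarrow>0\<rightarrow> 0" by (rule tendsto_ident_at)
      have "norm ((max 0 h)\<^sup>2 / h) \<le> norm h * (1::real)" for h :: real
        by (cases "h > 0") (auto simp: power2_eq_square)
      then show "\<forall>\<^sub>F h::real in at 0. norm ((max 0 h)\<^sup>2 / h) \<le> norm h * (1::real)"
        by (intro always_eventually allI)
    qed
    then show ?thesis using 3 by (simp add: DERIV_def)
  qed
qed

lemma has_field_derivative_along_axis:
  assumes "real_polynomial_function f"
  shows "((\<lambda>h. f (x + h *\<^sub>R axis i 1)) has_field_derivative partial_deriv i f (x + h *\<^sub>R axis i 1)) (at h)"
proof -
  let ?y = "x + h *\<^sub>R axis i 1"
  have lin: "linear (frechet_derivative f (at ?y))"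
    using real_polynomial_has_derivative[OF assms] has_derivative_linear by blast
  have "((\<lambda>h. f (x + h *\<^sub>R axis i 1)) has_derivative
      (\<lambda>t. frechet_derivative f (at ?y) (0 + t *\<^sub>R axis i 1))) (at h)"
    by (rule has_derivative_compose[OF has_derivative_add[OF has_derivative_const
          has_derivative_scaleR_left[OF has_derivative_ident]] real_polynomial_has_derivative[OF assms]])
  then show ?thesis
    by (simp add: has_field_derivative_def partial_deriv_def linear_scale[OF lin] mult_commute_abs)
qed

lemma set_integrable_cball_continuous:
  fixes f :: "'a::euclidean_space \<Rightarrow> real"
  assumes "continuous_on UNIV f"
  shows "set_integrable lborel (cball 0 1) f"
  unfolding set_integrable_def
  by (rule borel_integrable_compact) (use assms in \<open>auto intro: continuous_on_subset\<close>)

text \<open>The square of the cut-off weight makes the extension by zero continuously differentiable,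
  so that the integral of its derivative vanishes by translation invariance.\<close>

lemma integral_partial_deriv_weighted:
  fixes P :: "real ^ 'n::finite \<Rightarrow> real"
  assumes P: "real_polynomial_function P"
  shows "(LBINT x:cball 0 1. partial_deriv i P x * (1 - (norm x)\<^sup>2)\<^sup>2 - 4 * (x $ i * P x) * (1 - (norm x)\<^sup>2)) = 0"
proof -
  define m where "m = (\<lambda>x::real^'n. max 0 (1 - (norm x)\<^sup>2))"
  define e where "e = (axis i 1 :: real^'n)"
  define \<phi> where "\<phi> = (\<lambda>x. P x * (m x)\<^sup>2)"
  \<comment> \<open>The derivative of \<phi> along the axis. The 4 is the 2 from the square times
    the 2 from |x|^2, and the formula holds on both sides of the sphere.\<close>
  define \<phi>' where "\<phi>' = (\<lambda>x. partial_deriv i P x * (m x)\<^sup>2 - 4 * (x $ i * P x) * m x)"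
  have cP: "continuous_on S P" "continuous_on S (partial_deriv i P)" for S
    using P by (auto intro!: continuous_on_real_polynomial_function real_polynomial_function_partial_deriv)
  have cm: "continuous_on S m" for S unfolding m_def by (intro continuous_intros)
  have c\<phi>: "continuous_on S \<phi>" and c\<phi>': "continuous_on S \<phi>'" for S
    unfolding \<phi>_def \<phi>'_def by (intro continuous_intros cP cm continuous_on_component)+
  have m0: "m x = 0" if "x \<notin> cball 0 1" for x
    using that power_mono[of 1 "norm x" 2] by (auto simp: m_def)
  \<comment> \<open>A box containing the ball of radius 2 contains every translate of the unit ball
    by less than 1, so the domain of integration can stay fixed and compact while h varies.\<close>
  obtain b where b: "cball (0::real^'n) 2 \<subseteq> cbox (-b) b"
    using bounded_subset_cbox_symmetric[of "cball (0::real^'n) 2"] by auto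
  have supp: "m (x + h *\<^sub>R e) = 0" if "x \<notin> cbox (-b) b" "h \<in> {-1<..<1}" for x h
  proof (rule m0)
    have "x \<notin> cball 0 2" using that b by blast
    then have "norm x > 2" by simp
    moreover have "norm (h *\<^sub>R e) < 1" using that by (auto simp: e_def)
    moreover have "norm x \<le> norm (x + h *\<^sub>R e) + norm (h *\<^sub>R e)"
      using norm_triangle_ineq4[of "x + h *\<^sub>R e" "h *\<^sub>R e"] by simp
    ultimately show "x + h *\<^sub>R e \<notin> cball 0 1" by simp
  qed
  have shift: "integral (cbox (-b) b) (\<lambda>x. \<phi> (x + h *\<^sub>R e)) = (LINT x|lborel. \<phi> x)"
    if h: "h \<in> {-1<..<1}" for h
  proof -
    have "set_integrable lborel (cbox (-b) b) (\<lambda>x. \<phi> (x + h *\<^sub>R e))"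
      unfolding set_integrable_def
      by (intro borel_integrable_compact compact_cbox continuous_on_compose2[OF c\<phi>[of UNIV]] continuous_intros) auto
    then have "integral (cbox (-b) b) (\<lambda>x. \<phi> (x + h *\<^sub>R e)) = (LINT x:cbox (-b) b|lborel. \<phi> (x + h *\<^sub>R e))"
      by (simp add: set_borel_integral_eq_integral)
    also have "\<dots> = (LINT x|lborel. \<phi> (x + h *\<^sub>R e))"
      unfolding set_lebesgue_integral_def
      using supp h by (intro Bochner_Integration.integral_cong refl) (auto simp: indicator_def \<phi>_def)
    also have "\<dots> = (LINT x|distr lborel borel ((+) (h *\<^sub>R e)). \<phi> x)"
      by (subst integral_distr) (auto simp: add.commute intro: borel_measurable_continuous_onI c\<phi>)
    finally show ?thesis by (simp add: lborel_distr_plus)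
  qed
  have deriv: "((\<lambda>h. \<phi> (x + h *\<^sub>R e)) has_field_derivative \<phi>' (x + h *\<^sub>R e)) (at h within U)" for x h U
  proof -
    have "((\<lambda>h. 1 - (norm (x + h *\<^sub>R e))\<^sup>2) has_field_derivative 0 - 2 * (x + h *\<^sub>R e) $ i) (at h)"
      using has_field_derivative_along_axis[OF real_polynomial_function_power_norm, of x i h]
      unfolding partial_deriv_power_norm e_def by (intro DERIV_diff DERIV_const)
    then have "((\<lambda>h. (m (x + h *\<^sub>R e))\<^sup>2) has_field_derivative 2 * m (x + h *\<^sub>R e) * (0 - 2 * (x + h *\<^sub>R e) $ i)) (at h)"
      unfolding m_def by (rule DERIV_chain2[OF DERIV_max_0_power2])
    moreover have "((\<lambda>h. P (x + h *\<^sub>R e)) has_field_derivative partial_deriv i P (x + h *\<^sub>R e)) (at h)"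
      unfolding e_def by (rule has_field_derivative_along_axis[OF P])
    ultimately have "((\<lambda>h. \<phi> (x + h *\<^sub>R e)) has_field_derivative
        partial_deriv i P (x + h *\<^sub>R e) * (m (x + h *\<^sub>R e))\<^sup>2 +
        2 * m (x + h *\<^sub>R e) * (0 - 2 * (x + h *\<^sub>R e) $ i) * P (x + h *\<^sub>R e)) (at h)"
      unfolding \<phi>_def by (rule DERIV_mult[rotated])
    then show ?thesis
      by (rule has_field_derivative_at_within[OF DERIV_cong]) (simp add: \<phi>'_def algebra_simps)
  qed
  have "((\<lambda>h. integral (cbox (-b) b) (\<lambda>x. \<phi> (x + h *\<^sub>R e))) has_field_derivative
      integral (cbox (-b) b) (\<lambda>x. \<phi>' (x + 0 *\<^sub>R e))) (at 0 within {-1<..<1})"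
  proof (rule leibniz_rule_field_derivative)
    show "continuous_on ({-1<..<1} \<times> cbox (-b) b) (\<lambda>(h, x). \<phi>' (x + h *\<^sub>R e))"
      unfolding split_beta by (intro continuous_on_compose2[OF c\<phi>'[of UNIV]] continuous_intros) auto
    show "(\<lambda>x. \<phi> (x + h *\<^sub>R e)) integrable_on cbox (-b) b" for h
      by (intro integrable_continuous continuous_on_compose2[OF c\<phi>[of UNIV]] continuous_intros) auto
  qed (auto intro: deriv)
  then have D: "((\<lambda>h. integral (cbox (-b) b) (\<lambda>x. \<phi> (x + h *\<^sub>R e))) has_field_derivative
      integral (cbox (-b) b) \<phi>') (at 0)"
    by (simp add: at_within_open[of 0 "{-1<..<1::real}"])
  have "((\<lambda>h::real. (LINT x|lborel. \<phi> x)) has_field_derivative 0) (at 0)" by simp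
  then have "((\<lambda>h. integral (cbox (-b) b) (\<lambda>x. \<phi> (x + h *\<^sub>R e))) has_field_derivative 0) (at 0)"
    by (rule has_field_derivative_transform_within_open[of _ _ _ "{-1<..<1}"]) (use shift in auto)
  then have "integral (cbox (-b) b) \<phi>' = 0" using D DERIV_unique by blast
  moreover have "set_integrable lborel (cbox (-b) b) \<phi>'"
    unfolding set_integrable_def by (intro borel_integrable_compact compact_cbox c\<phi>')
  ultimately have "(LINT x:cbox (-b) b|lborel. \<phi>' x) = 0" by (simp add: set_borel_integral_eq_integral)
  also have "(LINT x:cbox (-b) b|lborel. \<phi>' x) = (LBINT x:cball 0 1. partial_deriv i P x * (1 - (norm x)\<^sup>2)\<^sup>2 -
      4 * (x $ i * P x) * (1 - (norm x)\<^sup>2))"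
    unfolding set_lebesgue_integral_def
  proof (intro Bochner_Integration.integral_cong refl)
    fix x :: "real^'n"
    show "indicator (cbox (-b) b) x *\<^sub>R \<phi>' x = indicator (cball 0 1) x *\<^sub>R
      (partial_deriv i P x * (1 - (norm x)\<^sup>2)\<^sup>2 - 4 * (x $ i * P x) * (1 - (norm x)\<^sup>2))"
    proof (cases "x \<in> cball 0 1")
      case True
      then have "x \<in> cball 0 2" by simp
      then have "x \<in> cbox (-b) b" using b by blast
      moreover have "m x = 1 - (norm x)\<^sup>2" using True by (simp add: m_def power_le_one)
      ultimately show ?thesis using True by (simp add: \<phi>'_def)
    qed (simp add: \<phi>'_def m0)
  qed
  finally show ?thesis .
qed

text \<open>The field P = g grad f - f grad g has divergence (Lap f) g - f Lap g, and Euler's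
  identity gives x . P = (k - l) f g, which is all that the gradient of the radial weight
  sees.\<close>

lemma green_identity_homogeneous:
  fixes f g :: "real ^ 'n::finite \<Rightarrow> real"
  assumes f: "f \<in> homogeneous_polys k" and g: "g \<in> homogeneous_polys l"
  shows "(LBINT x:cball 0 1. (laplacian f x * g x - f x * laplacian g x) * (1 - (norm x)\<^sup>2)\<^sup>2) =
    4 * (real k - real l) * (LBINT x:cball 0 1. (f x * g x) * (1 - (norm x)\<^sup>2))"
proof -
  note rf = homogeneous_polys_imp_real_polynomial_function[OF f]
    and rg = homogeneous_polys_imp_real_polynomial_function[OF g]
  define P where "P = (\<lambda>i x. partial_deriv i f x * g x - f x * partial_deriv i g x)"
  have rP: "real_polynomial_function (P i)" for i
    unfolding P_def by (intro real_polynomial_function_diff real_polynomial_function.intros(4)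
        real_polynomial_function_partial_deriv rf rg)
  have dP: "partial_deriv i (P i) x =
      partial_deriv i (partial_deriv i f) x * g x - f x * partial_deriv i (partial_deriv i g) x" for i x
    unfolding P_def
    by (simp add: partial_deriv_diff partial_deriv_mult rf rg real_polynomial_function_partial_deriv
        real_polynomial_function.intros(4))
  have sum_dP: "(\<Sum>i\<in>UNIV. partial_deriv i (P i) x) = laplacian f x * g x - f x * laplacian g x" for x
    by (simp add: dP laplacian_def sum_subtractf sum_distrib_left sum_distrib_right)
  have sum_xP: "(\<Sum>i\<in>UNIV. x $ i * P i x) = (real k - real l) * (f x * g x)" for x
  proof -
    have "(\<Sum>i\<in>UNIV. x $ i * P i x) = normal_deriv f x * g x - f x * normal_deriv g x"
      by (simp add: P_def normal_deriv_def sum_subtractf sum_distrib_left sum_distrib_right right_diff_distrib mult_ac)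
    then show ?thesis
      by (simp add: normal_deriv_homogeneous[OF f] normal_deriv_homogeneous[OF g] algebra_simps)
  qed
  define F where "F = (\<lambda>i x. partial_deriv i (P i) x * (1 - (norm x)\<^sup>2)\<^sup>2 - 4 * (x $ i * P i x) * (1 - (norm x)\<^sup>2))"
  have cont: "continuous_on UNIV h" if "real_polynomial_function h" for h :: "real^'n \<Rightarrow> real"
    using that by (rule continuous_on_real_polynomial_function)
  have "set_integrable lborel (cball 0 1) (F i)" for i
    unfolding F_def
    by (intro set_integrable_cball_continuous continuous_intros cont rP real_polynomial_function_partial_deriv)
  then have "(LBINT x:cball 0 1. (\<Sum>i\<in>UNIV. F i x)) = (\<Sum>i\<in>UNIV. (LBINT x:cball 0 1. F i x))"
    unfolding set_lebesgue_integral_def set_integrable_def scaleR_sum_right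
    by (intro Bochner_Integration.integral_sum) auto
  also have "\<dots> = 0"
    unfolding F_def by (simp add: integral_partial_deriv_weighted rP)
  finally have 0: "(LBINT x:cball 0 1. (\<Sum>i\<in>UNIV. F i x)) = 0" .
  have sum_F: "(\<Sum>i\<in>UNIV. F i x) = (laplacian f x * g x - f x * laplacian g x) * (1 - (norm x)\<^sup>2)\<^sup>2
      - 4 * (real k - real l) * ((f x * g x) * (1 - (norm x)\<^sup>2))" for x
  proof -
    have "(\<Sum>i\<in>UNIV. F i x) = (\<Sum>i\<in>UNIV. partial_deriv i (P i) x) * (1 - (norm x)\<^sup>2)\<^sup>2
        - 4 * (\<Sum>i\<in>UNIV. x $ i * P i x) * (1 - (norm x)\<^sup>2)"
      unfolding F_def by (simp only: sum_subtractf sum_distrib_left sum_distrib_right)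
    then show ?thesis by (simp add: sum_dP sum_xP)
  qed
  have "set_integrable lborel (cball 0 1) (\<lambda>x. (laplacian f x * g x - f x * laplacian g x) * (1 - (norm x)\<^sup>2)\<^sup>2)"
    "set_integrable lborel (cball 0 1) (\<lambda>x. 4 * (real k - real l) * ((f x * g x) * (1 - (norm x)\<^sup>2)))"
    by (intro set_integrable_cball_continuous continuous_intros cont rf rg real_polynomial_function_laplacian)+
  then show ?thesis using 0 unfolding sum_F by (simp add: set_integral_diff)
qed

section \<open>Beta integrals and the passage from ball to sphere\<close>

lemma
  assumes a: "a > -1" and b: "b > -1"
  shows beta_integrable: "set_integrable lborel {0..1} (\<lambda>v::real. (1 - v) powr b * v powr a)"
    and beta_integral_pos: "(LBINT v:{0..1}. (1 - v) powr b * v powr a) > 0"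
proof -
  show int: "set_integrable lborel {0..1} (\<lambda>v::real. (1 - v) powr b * v powr a)"
    using integrable_Beta[of "a + 1" "b + 1"] a b by (simp add: mult.commute)
  have "(LBINT v:{0..1}. (1 - v) powr b * v powr a) = Beta (a + 1) (b + 1)"
    using has_integral_Beta_real[of "a + 1" "b + 1"] a b set_borel_integral_eq_integral(2)[OF int]
    by (simp add: mult.commute integral_unique)
  also have "\<dots> > 0" using a b by (simp add: Beta_def Gamma_real_pos)
  finally show "(LBINT v:{0..1}. (1 - v) powr b * v powr a) > 0" .
qed

text \<open>The radial factor depends only on \<open>m\<close> and \<open>j\<close> and is a
  positive Beta integral. Hence vanishing on the ball and vanishing on the sphere are equivalent for
  homogeneous integrands, whatever power of the weight is present.\<close>

lemma homogeneous_weighted_ball_integral: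
  assumes "j > 0"
  shows "\<exists>c>0. \<forall>Z \<in> homogeneous_polys m. (LBINT x:cball (0 :: real ^ 'n::finite) 1. Z x * (1 - (norm x)\<^sup>2) ^ j) =
      c * (LINT x|sphere_measure. Z x)"
proof -
  define s where "s = real m / 2 + real CARD('n) / 2 - 1"
  have s: "s > -1" by (simp add: s_def add_nonneg_pos)
  define c where "c = (LBINT v:{0..1}. (1 - v) powr real j * v powr s) / 2"
  have "(LBINT x:cball 0 1. Z x * (1 - (norm x)\<^sup>2) ^ j) = c * (LINT x|sphere_measure. Z x)"
    if Z: "Z \<in> homogeneous_polys m" for Z :: "real^'n \<Rightarrow> real"
  proof -
    \<comment> \<open>On the boundary the two powers agree because j > 0: \<open>0 ^ 0\<close> is 1
      whereas \<open>0 powr 0\<close> is 0.\<close>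
    have "Z x * (1 - (norm x)\<^sup>2) ^ j = (1 - (norm x)\<^sup>2) powr real j * Z x" if "x \<in> cball 0 1" for x :: "real^'n"
    proof (cases "norm x = 1")
      case False
      then have "(norm x)\<^sup>2 < 1" using that by (simp add: power_less_one_iff abs_square_less_1)
      then show ?thesis by (simp add: powr_realpow mult.commute)
    qed (use \<open>j > 0\<close> in simp)
    then have "(LBINT x:cball 0 1. Z x * (1 - (norm x)\<^sup>2) ^ j) =
        (LBINT x:cball 0 1. (1 - (norm x)\<^sup>2) powr real j * Z x)"
      by (intro set_lebesgue_integral_cong) auto
    also have "\<dots> = c * (LINT x|sphere_measure. Z x)"
      using radial_homogeneous_integral(2)[OF Z, of "\<lambda>v. (1 - v) powr real j"] beta_integrable[OF s, of "real j"]
      by (simp add: s_def c_def)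
    finally show ?thesis .
  qed
  moreover have "c > 0" using beta_integral_pos[OF s, of "real j"] by (simp add: c_def)
  ultimately show ?thesis by blast
qed

lemma homogeneous_weighted_ball_integral_eq_0_iff:
  assumes "Z \<in> homogeneous_polys m" "j > 0"
  shows "(LBINT x:cball 0 1. Z x * (1 - (norm x)\<^sup>2) ^ j) = 0 \<longleftrightarrow>
    (LINT x|(sphere_measure :: (real ^ 'n::finite) measure). Z x) = 0"
  using homogeneous_weighted_ball_integral[OF assms(2), of m, where ?'n = 'n] assms(1) by force

text \<open>Both Laplacians vanish, so Green's identity leaves (k - l) times the weighted integral
  of f g equal to 0.\<close>

lemma harmonic_polys_orthogonal:
  fixes f g :: "real ^ 'n::finite \<Rightarrow> real"
  assumes f: "f \<in> harmonic_polys k" and g: "g \<in> harmonic_polys l" and "k \<noteq> l"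
  shows "(LINT x|sphere_measure. f x * g x) = 0"
proof -
  have fh: "f \<in> homogeneous_polys k" and gh: "g \<in> homogeneous_polys l"
    and "\<And>x. laplacian f x = 0" "\<And>x. laplacian g x = 0"
    using f g by (auto simp: harmonic_polys_def)
  then have "(LBINT x:cball 0 1. (f x * g x) * (1 - (norm x)\<^sup>2) ^ 1) = 0"
    using green_identity_homogeneous[OF fh gh] \<open>k \<noteq> l\<close> by (simp add: set_lebesgue_integral_def)
  then show ?thesis
    using homogeneous_weighted_ball_integral_eq_0_iff[OF homogeneous_polys_mult[OF fh gh], of 1] by simp
qed

text \<open>Green's identity is applied to g and h = Lap g. The terms with g h and g Lap h vanish by
  orthogonality, so the integral of h^2 against a positive weight is 0 and h = 0.\<close>

lemma harmonic_if_orthogonal: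
  fixes g :: "real ^ 'n::finite \<Rightarrow> real"
  assumes g: "g \<in> homogeneous_polys n" and n: "n \<ge> 2"
    and orth: "\<And>p. p \<in> homogeneous_polys (n - 2) \<Longrightarrow> (LINT x|sphere_measure. g x * p x) = 0"
  shows "g \<in> harmonic_polys n"
proof -
  define h where "h = laplacian g"
  have h: "h \<in> homogeneous_polys (n - 2)" unfolding h_def by (rule laplacian_homogeneous[OF g])
  have lh: "laplacian h \<in> homogeneous_polys (n - 2 - 2)" by (rule laplacian_homogeneous[OF h])
  have "(LINT x|sphere_measure. g x * laplacian h x) = 0"
  proof (cases "n - 2 < 2")
    case True
    then show ?thesis using laplacian_homogeneous_less_2[OF h] by simp
  next
    case False
    then have "2 + (n - 2 - 2) = n - 2" by simp
    \<comment> \<open>Orthogonality is assumed only in degree n - 2. Multiplication by |x|^2 raises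
      \<open>laplacian h\<close> to that degree without changing it on the sphere.\<close>
    then have "(\<lambda>x. (norm x)\<^sup>2 * laplacian h x) \<in> homogeneous_polys (n - 2)"
      using homogeneous_polys_mult[OF homogeneous_polys_power_norm lh] by metis
    from orth[OF this] show ?thesis
      by (subst (asm) integral_sphere_measure_cong[where g = "\<lambda>x. g x * laplacian h x"]) auto
  qed
  then have 1: "(LBINT x:cball 0 1. (g x * laplacian h x) * (1 - (norm x)\<^sup>2) ^ 2) = 0"
    using homogeneous_weighted_ball_integral_eq_0_iff[OF homogeneous_polys_mult[OF g lh], of 2] by simp
  have 2: "(LBINT x:cball 0 1. (g x * h x) * (1 - (norm x)\<^sup>2) ^ 1) = 0"
    using homogeneous_weighted_ball_integral_eq_0_iff[OF homogeneous_polys_mult[OF g h], of 1] orth[OF h] by simp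
  note cont = continuous_on_real_polynomial_function[OF homogeneous_polys_imp_real_polynomial_function]
  have "(LBINT x:cball 0 1. (h x * h x) * (1 - (norm x)\<^sup>2) ^ 2) =
     (LBINT x:cball 0 1. (h x * h x - g x * laplacian h x) * (1 - (norm x)\<^sup>2) ^ 2)
     + (LBINT x:cball 0 1. (g x * laplacian h x) * (1 - (norm x)\<^sup>2) ^ 2)"
    by (subst set_integral_add(2)[symmetric])
       (auto intro!: set_integrable_cball_continuous continuous_intros cont[OF h] cont[OF g] cont[OF lh]
         simp: algebra_simps)
  also have "\<dots> = 0" using green_identity_homogeneous[OF g h] 1 2 by (simp add: h_def)
  finally have "(LINT x|sphere_measure. h x * h x) = 0"
    using homogeneous_weighted_ball_integral_eq_0_iff[OF homogeneous_polys_mult[OF h h], of 2] by simp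
  then have "h = 0" using homogeneous_sphere_zero_imp_zero[OF h] by simp
  then show ?thesis using g by (simp add: harmonic_polys_def h_def)
qed

section \<open>Decomposition of homogeneous polynomials into harmonics\<close>

lemma real_module_raw:
  "module.subspace (*\<^sub>R) = subspace" "module.span (*\<^sub>R) = span" "module.dependent (*\<^sub>R) = dependent"
  by (simp_all add: subspace_raw_def span_raw_def dependent_raw_def)

lemma sphere_symmetric_form:
  assumes V: "subspace V" "V \<subseteq> {f. real_polynomial_function f}"
  shows "symmetric_form scaleR V (\<lambda>f g. LINT x|(sphere_measure :: (real ^ 'n::finite) measure). f x * g x)"
proof -
  have int: "integrable sphere_measure (\<lambda>x. f x * g x)" if "f \<in> V" "g \<in> V" for f g :: "real^'n \<Rightarrow> real"
    using that V(2)
    by (intro integrable_sphere_measure_continuous continuous_intros continuous_on_real_polynomial_function) auto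
  show ?thesis
  proof unfold_locales
    show "module.subspace scaleR V" unfolding real_module_raw by (rule V(1))
  qed (auto simp: plus_fun_def scaleR_fun_def int distrib_right mult.assoc, simp add: mult.commute)
qed

text \<open>f is projected onto the multiples of |x|^2, orthogonally on the sphere. There |x|^2 = 1,
  so the residual is orthogonal to every homogeneous polynomial of degree n - 2 and is therefore
  harmonic.\<close>

lemma homogeneous_polys_decompose_harmonic:
  fixes f :: "real ^ 'n::finite \<Rightarrow> real"
  assumes f: "f \<in> homogeneous_polys n" and n: "n \<ge> 2"
  shows "\<exists>p \<in> homogeneous_polys (n - 2). f - (\<lambda>x. (norm x)\<^sup>2 * p x) \<in> harmonic_polys n"
proof -
  interpret symmetric_form scaleR "homogeneous_polys n"
      "\<lambda>f g. LINT x|(sphere_measure :: (real ^ 'n) measure). f x * g x"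
    rewrites "module.subspace (*\<^sub>R) = subspace" and "module.span (*\<^sub>R) = span"
      and "module.dependent (*\<^sub>R) = dependent"
    by (rule sphere_symmetric_form)
       (auto simp: real_module_raw subspace_homogeneous_polys homogeneous_polys_imp_real_polynomial_function)
  obtain S :: "(real^'n \<Rightarrow> real) set" where S: "finite S" "homogeneous_polys (n - 2) = span S"
    using homogeneous_polys_finite_span by blast
  define L where "L = (\<lambda>(p :: real^'n \<Rightarrow> real) x. (norm x)\<^sup>2 * p x)"
  have "linear L"
    by (rule linearI) (auto simp: L_def plus_fun_def scaleR_fun_def algebra_simps)
  then have sp: "span (L ` S) = L ` homogeneous_polys (n - 2)" by (simp add: linear_span_image S)
  have Lh: "L p \<in> homogeneous_polys n" if "p \<in> homogeneous_polys (n - 2)" for p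
    using homogeneous_polys_mult[OF homogeneous_polys_power_norm that] n unfolding L_def
    by (metis le_add_diff_inverse)
  have "L ` S \<subseteq> homogeneous_polys n" using Lh span_superset[of S] by (auto simp: S)
  then have "\<exists>w \<in> span (L ` S). \<forall>s \<in> span (L ` S). (LINT x|sphere_measure. (f - w) x * s x) = 0"
    using S f homogeneous_sphere_zero_imp_zero[of _ n] by (intro orthogonal_projection_exists) auto
  then obtain p where p: "p \<in> homogeneous_polys (n - 2)"
    and orth: "\<And>q. q \<in> homogeneous_polys (n - 2) \<Longrightarrow> (LINT x|sphere_measure. (f - L p) x * L q x) = 0"
    unfolding sp by blast
  have "f - L p \<in> harmonic_polys n"
  proof (rule harmonic_if_orthogonal[OF _ n])
    show "f - L p \<in> homogeneous_polys n"
      using f Lh[OF p] subspace_homogeneous_polys subspace_diff by blast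
    show "(LINT x|sphere_measure. (f - L p) x * q x) = 0" if "q \<in> homogeneous_polys (n - 2)" for q
      using orth[OF that] integral_sphere_measure_cong[of "\<lambda>x. (f - L p) x * L q x" "\<lambda>x. (f - L p) x * q x"]
      by (simp add: L_def)
  qed
  then show ?thesis using p by (auto simp: L_def)
qed

text \<open>The target is an arbitrary subspace \<open>U\<close> so that the induction can pass to
  its preimage under multiplication by |x|^2, which lowers the degree by 2 and raises j by
  1.\<close>

lemma homogeneous_polys_subset_if_harmonic:
  fixes U :: "(real ^ 'n::finite \<Rightarrow> real) set"
  assumes "subspace U"
    and "\<And>j Y. \<lbrakk>2 * j \<le> n; Y \<in> harmonic_polys (n - 2 * j)\<rbrakk> \<Longrightarrow> (\<lambda>x. ((norm x)\<^sup>2) ^ j * Y x) \<in> U"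
  shows "homogeneous_polys n \<subseteq> U"
  using assms
proof (induction n arbitrary: U rule: less_induct)
  case (less n)
  have harm: "harmonic_polys n \<subseteq> U" using less.prems(2)[of 0] by auto
  show ?case
  proof
    fix f :: "real^'n \<Rightarrow> real" assume f: "f \<in> homogeneous_polys n"
    show "f \<in> U"
    proof (cases "n < 2")
      case True
      then show ?thesis
        using f harm laplacian_homogeneous_less_2[OF f] by (auto simp: harmonic_polys_def)
    next
      case False
      define L where "L = (\<lambda>(p :: real^'n \<Rightarrow> real) x. (norm x)\<^sup>2 * p x)"
      obtain p where p: "p \<in> homogeneous_polys (n - 2)" "f - L p \<in> harmonic_polys n"
        using homogeneous_polys_decompose_harmonic[OF f] False unfolding L_def by auto
      have lin: "linear L"
        by (rule linearI) (auto simp: L_def plus_fun_def scaleR_fun_def algebra_simps)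
      have "homogeneous_polys (n - 2) \<subseteq> L -` U"
      proof (rule less.IH)
        show "subspace (L -` U)" using lin less.prems(1) by (rule linear_subspace_vimage)
        fix j :: nat and Y :: "real^'n \<Rightarrow> real"
        assume "2 * j \<le> n - 2" "Y \<in> harmonic_polys (n - 2 - 2 * j)"
        then have "(\<lambda>x. ((norm x)\<^sup>2) ^ Suc j * Y x) \<in> U"
          using False by (intro less.prems(2)) auto
        then show "(\<lambda>x. ((norm x)\<^sup>2) ^ j * Y x) \<in> L -` U" by (simp add: L_def mult.assoc)
      qed (use False in auto)
      then have "L p + (f - L p) \<in> U"
        using p harm less.prems(1) by (intro subspace_add) auto
      then show ?thesis by simp
    qed
  qed
qed

section \<open>Univariate Sobolev orthogonal polynomials\<close>


locale definite_poly_form = symmetric_form "smult :: 'a::field \<Rightarrow> 'a poly \<Rightarrow> 'a poly" UNIV B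
  for B :: "'a::field poly \<Rightarrow> 'a poly \<Rightarrow> 'a" +
  assumes form_self_eq_0: "B p p = 0 \<Longrightarrow> p = 0"
begin

text \<open>Low degree is expressed by vanishing coefficients from \<open>n\<close> on, since
  \<open>degree\<close> cannot single out the zero polynomial; the base case n = 0 then says exactly
  \<open>p = 0\<close>.\<close>

lemma in_span_triangular:
  assumes deg: "\<And>j. degree (q j) = j" and nz: "\<And>j. q j \<noteq> 0" and p: "\<And>i. i \<ge> n \<Longrightarrow> coeff p i = 0"
  shows "p \<in> span (q ` {..<n})"
  using p
proof (induction n arbitrary: p)
  case 0
  then have "p = 0" by (simp add: poly_eq_iff)
  then show ?case by (simp add: span_zero)
next
  case (Suc n)
  define c where "c = coeff p n / coeff (q n) n"
  have qn: "coeff (q n) n \<noteq> 0" using nz[of n] deg[of n] leading_coeff_0_iff[of "q n"] by simp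
  have "p - smult c (q n) \<in> span (q ` {..<n})"
  proof (rule Suc.IH)
    fix i assume "i \<ge> n"
    then consider "i = n" | "i \<ge> Suc n" by linarith
    then show "coeff (p - smult c (q n)) i = 0"
      using Suc.prems qn deg[of n] by cases (auto simp: c_def coeff_eq_0)
  qed
  moreover have "span (q ` {..<n}) \<subseteq> span (q ` {..<Suc n})" by (intro span_mono) auto
  moreover have "smult c (q n) \<in> span (q ` {..<Suc n})" by (intro span_scale span_base) auto
  ultimately have "(p - smult c (q n)) + smult c (q n) \<in> span (q ` {..<Suc n})"
    by (intro span_add) auto
  then show ?case by simp
qed

lemma orthogonal_triangular:
  assumes deg: "\<And>j. degree (q j) = j" and nz: "\<And>j. q j \<noteq> 0"
    and orth: "\<And>i j. i \<noteq> j \<Longrightarrow> B (q i) (q j) = 0" and p: "\<And>i. i \<ge> n \<Longrightarrow> coeff p i = 0"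
  shows "B (q n) p = 0"
  by (rule orthogonal_to_span[OF _ _ _ in_span_triangular[OF deg nz p]]) (auto intro: orth)

text \<open>Existence takes the residual of the monomial of degree j after projection onto lower
  degrees and rescales it. For uniqueness, the difference of two candidates has lower degree, so it
  is orthogonal to both and hence to itself.\<close>

lemma ex1_orthogonal_polynomials:
  assumes \<kappa>: "\<And>j. \<kappa> j \<noteq> 0"
  shows "\<exists>!q. (\<forall>j. degree (q j) = j \<and> lead_coeff (q j) = \<kappa> j) \<and> (\<forall>i j. i \<noteq> j \<longrightarrow> B (q i) (q j) = 0)"
proof (rule ex_ex1I)
  \<comment> \<open>Orthogonality to all polynomials of lower degree, instead of to the earlier
    members, lets each degree be chosen independently.\<close>
  have "\<exists>r. degree r = j \<and> lead_coeff r = \<kappa> j \<and> (\<forall>p. (\<forall>i\<ge>j. coeff p i = 0) \<longrightarrow> B r p = 0)" for j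
  proof -
    obtain w where w: "w \<in> span (monom 1 ` {..<j})" "\<And>s. s \<in> span (monom 1 ` {..<j}) \<Longrightarrow> B (monom 1 j - w) s = 0"
      using orthogonal_projection_exists[of "monom 1 ` {..<j}" "monom 1 j"] form_self_eq_0 by auto
    have "\<forall>i\<ge>j. coeff w i = 0"
      using w(1) by (induction rule: span_induct_alt) auto
    then have cf: "coeff (monom 1 j - w) j = 1" "\<And>i. i > j \<Longrightarrow> coeff (monom 1 j - w) i = 0" by auto
    then have deg: "degree (monom 1 j - w) = j"
      by (metis degree_le le_antisym le_degree not_le_imp_less zero_neq_one)
    have "B (smult (\<kappa> j) (monom 1 j - w)) p = 0" if "\<forall>i\<ge>j. coeff p i = 0" for p
    proof -
      have "p \<in> span (monom 1 ` {..<j})"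
        by (rule in_span_triangular) (use that in \<open>auto simp: degree_monom_eq\<close>)
      then show ?thesis using w(2) form_scale by simp
    qed
    then show ?thesis
      using deg cf(1) \<kappa>[of j] by (intro exI[of _ "smult (\<kappa> j) (monom 1 j - w)"]) auto
  qed
  then obtain q where q: "\<And>j. degree (q j) = j" "\<And>j. lead_coeff (q j) = \<kappa> j"
    "\<And>j p. (\<forall>i\<ge>j. coeff p i = 0) \<Longrightarrow> B (q j) p = 0"
    by metis
  have "B (q i) (q j) = 0" if "i \<noteq> j" for i j
  proof (cases "i < j")
    case True
    then have "B (q j) (q i) = 0" by (intro q(3)) (auto simp: coeff_eq_0 q(1))
    then show ?thesis using form_commute[of "q i" "q j"] by simp
  next
    case False
    then show ?thesis using that by (intro q(3)) (auto simp: coeff_eq_0 q(1))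
  qed
  then show "\<exists>q. (\<forall>j. degree (q j) = j \<and> lead_coeff (q j) = \<kappa> j) \<and> (\<forall>i j. i \<noteq> j \<longrightarrow> B (q i) (q j) = 0)"
    using q by blast
next
  fix q q'
  assume q: "(\<forall>j. degree (q j) = j \<and> lead_coeff (q j) = \<kappa> j) \<and> (\<forall>i j. i \<noteq> j \<longrightarrow> B (q i) (q j) = 0)"
    and q': "(\<forall>j. degree (q' j) = j \<and> lead_coeff (q' j) = \<kappa> j) \<and> (\<forall>i j. i \<noteq> j \<longrightarrow> B (q' i) (q' j) = 0)"
  show "q = q'"
  proof
    fix j
    have nz: "q j \<noteq> 0" "q' j \<noteq> 0" for j
      using q q' \<kappa>[of j] by (metis coeff_0)+
    define d where "d = q j - q' j"
    have low: "coeff d i = 0" if "i \<ge> j" for i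
    proof (cases "i = j")
      case True
      have "coeff (q j) j = \<kappa> j" "coeff (q' j) j = \<kappa> j" using q q' by metis+
      then show ?thesis using True by (simp add: d_def)
    next
      case False
      then show ?thesis using that q q' by (simp add: d_def coeff_eq_0)
    qed
    have "B (q j) d = 0" "B (q' j) d = 0"
      using orthogonal_triangular[of q j d] orthogonal_triangular[of q' j d] q q' nz low by auto
    then have "B d d = 0" using form_diff[of "q j" "q' j" d] by (simp add: d_def)
    then show "q j = q' j" using form_self_eq_0[of d] by (simp add: d_def)
  qed
qed

end

section \<open>Jacobi weights and the Sobolev form on the interval\<close>

lemma set_integral_affine_unit:
  fixes F :: "real \<Rightarrow> real"
  shows "(LBINT t:{-1..1}. F t) = 2 * (LBINT v:{0..1}. F (2 * v - 1))"
    and "set_integrable lborel {-1..1} F \<longleftrightarrow> set_integrable lborel {0..1} (\<lambda>v. F (2 * v - 1))"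
proof -
  have eq: "indicator {-1..1} (-1 + 2 * v) *\<^sub>R F (-1 + 2 * v) = indicator {0..1} v *\<^sub>R F (2 * v - 1)" for v :: real
    by (auto simp: indicator_def)
  show "(LBINT t:{-1..1}. F t) = 2 * (LBINT v:{0..1}. F (2 * v - 1))"
    unfolding set_lebesgue_integral_def
    using lborel_integral_real_affine[of 2 "\<lambda>t. indicator {-1..1} t *\<^sub>R F t" "-1"] by (simp only: eq) simp
  show "set_integrable lborel {-1..1} F \<longleftrightarrow> set_integrable lborel {0..1} (\<lambda>v. F (2 * v - 1))"
    unfolding set_integrable_def
    using lborel_integrable_real_affine_iff[of 2 "\<lambda>t. indicator {-1..1} t *\<^sub>R F t" "-1"] by (simp only: eq)
qed

text \<open>The weights are unbounded at the boundary when an exponent is negative, so integrability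
  cannot come from continuity on a compact set; a bounded factor is added to a weight known to be
  integrable.\<close>

lemma set_integrable_mult_continuous:
  fixes f w :: "'a::euclidean_space \<Rightarrow> real"
  assumes S: "compact S" and f: "continuous_on UNIV f" and w: "set_integrable lborel S w"
  shows "set_integrable lborel S (\<lambda>x. f x * w x)"
proof -
  have "compact (f ` S)" using S f by (intro compact_continuous_image) (auto intro: continuous_on_subset)
  then obtain C where C: "\<And>x. x \<in> S \<Longrightarrow> \<bar>f x\<bar> \<le> C"
    using compact_imp_bounded[of "f ` S"] by (auto simp: bounded_iff)
  have [measurable]: "f \<in> borel_measurable borel" using f by (rule borel_measurable_continuous_onI)
  have [measurable]: "(\<lambda>x. indicator S x *\<^sub>R w x) \<in> borel_measurable borel"
    using w unfolding set_integrable_def by auto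
  have "integrable lborel (\<lambda>x. C * (indicator S x *\<^sub>R w x))"
    using w unfolding set_integrable_def by (rule integrable_mult_right)
  then have "integrable lborel (\<lambda>x. f x * (indicator S x *\<^sub>R w x))"
  proof (rule Bochner_Integration.integrable_bound)
    show "AE x in lborel. norm (f x * (indicator S x *\<^sub>R w x)) \<le> norm (C * (indicator S x *\<^sub>R w x))"
    proof (intro AE_I2)
      fix x :: 'a
      show "norm (f x * (indicator S x *\<^sub>R w x)) \<le> norm (C * (indicator S x *\<^sub>R w x))"
        using C[of x] by (auto simp: indicator_def abs_mult intro!: mult_right_mono)
    qed
  qed measurable
  then show ?thesis unfolding set_integrable_def by (simp add: mult.left_commute)
qed

lemma jacobi_weight_integrable:
  assumes "\<alpha> > -1" "\<beta> > -1"
  shows "set_integrable lborel {-1..1} (\<lambda>t::real. (1 - t) powr \<alpha> * (1 + t) powr \<beta>)"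
proof -
  have "set_integrable lborel {0..1} (\<lambda>v::real. 2 powr (\<alpha> + \<beta>) * ((1 - v) powr \<alpha> * v powr \<beta>))"
    using beta_integrable[OF assms(2,1)] by simp
  also have "?this \<longleftrightarrow> set_integrable lborel {0..1} (\<lambda>v::real. (1 - (2 * v - 1)) powr \<alpha> * (1 + (2 * v - 1)) powr \<beta>)"
  proof (rule set_integrable_cong[OF refl refl])
    fix v :: real assume "v \<in> {0..1}"
    then have "(2 * (1 - v)) powr \<alpha> = 2 powr \<alpha> * (1 - v) powr \<alpha>" "(2 * v) powr \<beta> = 2 powr \<beta> * v powr \<beta>"
      by (subst powr_mult, simp_all)+
    then show "2 powr (\<alpha> + \<beta>) * ((1 - v) powr \<alpha> * v powr \<beta>) = (1 - (2 * v - 1)) powr \<alpha> * (1 + (2 * v - 1)) powr \<beta>"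
      by (simp add: powr_add right_diff_distrib)
  qed
  finally show ?thesis by (simp only: set_integral_affine_unit(2))
qed

lemma jacobi_poly_integrable:
  assumes "\<alpha> > -1" "\<beta> > -1"
  shows "set_integrable lborel {-1..1} (\<lambda>t::real. poly f t * poly g t * (1 - t) powr \<alpha> * (1 + t) powr \<beta>)"
  using set_integrable_mult_continuous[OF _ _ jacobi_weight_integrable[OF assms], of "poly (f * g)"]
  by (simp add: mult.assoc continuous_intros)

lemma jacobi_integral_self:
  fixes f :: "real poly"
  assumes "\<alpha> > -1" "\<beta> > -1"
  shows "(LBINT t:{-1..1}. poly f t * poly f t * (1 - t) powr \<alpha> * (1 + t) powr \<beta>) \<ge> 0"
    and "(LBINT t:{-1..1}. poly f t * poly f t * (1 - t) powr \<alpha> * (1 + t) powr \<beta>) = 0 \<Longrightarrow> f = 0"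
proof -
  show "(LBINT t:{-1..1}. poly f t * poly f t * (1 - t) powr \<alpha> * (1 + t) powr \<beta>) \<ge> 0"
    unfolding set_lebesgue_integral_def
    by (intro Bochner_Integration.integral_nonneg) simp
  assume "(LBINT t:{-1..1}. poly f t * poly f t * (1 - t) powr \<alpha> * (1 + t) powr \<beta>) = 0"
  then have "AE t in lborel. indicator {-1..1} t *\<^sub>R (poly f t * poly f t * (1 - t) powr \<alpha> * (1 + t) powr \<beta>) = 0"
    using jacobi_poly_integrable[OF assms, of f f] unfolding set_lebesgue_integral_def set_integrable_def
    by (subst (asm) integral_nonneg_eq_0_iff_AE) auto
  \<comment> \<open>Only in the open interval is the weight known to be nonzero; this still leaves
    infinitely many roots.\<close>
  then have AE: "AE t in lborel. t \<in> {-1<..<1} \<longrightarrow> poly f t = 0"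
    by eventually_elim (auto simp: indicator_def)
  have "poly f t = 0" if "t \<in> {-1<..<1}" for t
    by (rule AE_zero_on_open_imp_zero[OF AE]) (use that in \<open>auto intro!: continuous_intros\<close>)
  then have "{-1<..<1} \<subseteq> {t. poly f t = 0}" by auto
  moreover have "infinite {-1<..<1::real}" by (simp add: infinite_Ioo)
  ultimately show "f = 0" using poly_roots_finite[of f] finite_subset by blast
qed

text \<open>Definiteness comes from the integral alone and \<open>M\<close> merely adds a
  nonnegative term. This matters because the matrices \<open>M k\<close> of the theorem are
  singular.\<close>

lemma jacobi_sobolev_inner_form:
  assumes \<alpha>: "\<alpha> > -1" "\<beta> > -1" and sym: "transpose M = M" and psd: "\<And>v. 0 \<le> (v v* M) \<bullet> v"
  shows "definite_poly_form (jacobi_sobolev_inner \<alpha> \<beta> M)"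
proof -
  interpret poly: vector_space "smult :: real \<Rightarrow> real poly \<Rightarrow> real poly"
    by unfold_locales (auto simp: smult_add_left smult_add_right)
  show ?thesis
  proof
  fix f g h :: "real poly" and c :: real
  note int = jacobi_poly_integrable[OF \<alpha>]
  have vadd: "vector [poly (f + g) 1, poly (pderiv (f + g)) 1] =
      (vector [poly f 1, poly (pderiv f) 1] + vector [poly g 1, poly (pderiv g) 1] :: real^2)"
    by (simp add: vec_eq_iff forall_2 pderiv_add)
  have vscale: "vector [poly (smult c f) 1, poly (pderiv (smult c f)) 1] =
      (c *\<^sub>R vector [poly f 1, poly (pderiv f) 1] :: real^2)"
    by (simp add: vec_eq_iff forall_2 pderiv_smult)
  show "jacobi_sobolev_inner \<alpha> \<beta> M (f + g) h = jacobi_sobolev_inner \<alpha> \<beta> M f h + jacobi_sobolev_inner \<alpha> \<beta> M g h"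
    unfolding jacobi_sobolev_inner_def vadd
    using int[of f h] int[of g h]
    by (simp add: distrib_right set_integral_add vector_matrix_left_distrib inner_add_left)
  show "jacobi_sobolev_inner \<alpha> \<beta> M (smult c f) h = c * jacobi_sobolev_inner \<alpha> \<beta> M f h"
    unfolding jacobi_sobolev_inner_def vscale
    by (simp add: mult.assoc distrib_left scaleR_vector_matrix_assoc)
  show "jacobi_sobolev_inner \<alpha> \<beta> M f h = jacobi_sobolev_inner \<alpha> \<beta> M h f"
  proof -
    have "(v v* M) \<bullet> w = (w v* M) \<bullet> v" for v w :: "real^2"
      using sym by (metis dot_lmul_matrix inner_commute transpose_matrix_vector)
    then show ?thesis by (simp add: jacobi_sobolev_inner_def mult.commute)
  qed
  show "f = 0" if "jacobi_sobolev_inner \<alpha> \<beta> M f f = 0"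
    using that jacobi_integral_self[OF \<alpha>, of f] psd[of "vector [poly f 1, poly (pderiv f) 1]"]
    unfolding jacobi_sobolev_inner_def by linarith
  qed (rule poly.subspace_UNIV)
qed

text \<open>The factors of the generalized binomial are 2j + \<alpha> + \<beta> - i with i <= j - 1,
  and \<alpha> + \<beta> > -2 makes each exceed j - 1 >= 0.\<close>

lemma jacobi_leading_coeff_pos:
  assumes "\<alpha> > -1" "\<beta> > (-1::real)"
  shows "((2 * real j + \<alpha> + \<beta>) gchoose j) / 2 ^ j > 0"
proof -
  have "2 * real j + \<alpha> + \<beta> - real i > 0" if "i < j" for i
  proof -
    have "real i + 1 \<le> real j" using that by linarith
    then show ?thesis using assms by linarith
  qed
  then show ?thesis by (auto simp: gbinomial_prod_rev intro!: divide_pos_pos prod_pos)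
qed

lemma is_jacobi_sobolev_seq_jacobi_sobolev:
  assumes "\<alpha> > -1" "\<beta> > -1" "transpose M = M" "\<And>v. 0 \<le> (v v* M) \<bullet> v"
  shows "is_jacobi_sobolev_seq \<alpha> \<beta> M (jacobi_sobolev \<alpha> \<beta> M)"
proof -
  interpret definite_poly_form "jacobi_sobolev_inner \<alpha> \<beta> M"
    using assms by (rule jacobi_sobolev_inner_form)
  have "\<exists>!q. is_jacobi_sobolev_seq \<alpha> \<beta> M q"
    unfolding is_jacobi_sobolev_seq_def
    using jacobi_leading_coeff_pos[OF assms(1,2)] by (intro ex1_orthogonal_polynomials) (metis less_irrefl)
  then show ?thesis unfolding jacobi_sobolev_def by (rule theI')
qed

section \<open>The Sobolev inner product on the ball\<close>


text \<open>The matrix is the outer product of (k, 4) with itself, and (k, 4) represents the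
  functional p -> k p(1) + 4 p'(1).\<close>

lemma quad_form_rank1:
  "(v v* (c *\<^sub>R vector [vector [k\<^sup>2, 4 * k], vector [4 * k, 16]])) \<bullet> w =
     c * (k * v $ 1 + 4 * v $ 2) * (k * w $ 1 + 4 * (w $ 2))" for v w :: "real ^ 2"
  by (simp add: vector_matrix_mult_def inner_vec_def sum_2 power2_eq_square algebra_simps)

lemma one_in_homogeneous_polys: "(\<lambda>x. 1) \<in> homogeneous_polys 0"
  by (auto simp: homogeneous_polys_iff intro: real_polynomial_function.intros)

lemma
  assumes mu: "mu > -1"
  shows ball_weight_integrable: "set_integrable lborel (cball 0 1) (ball_weight mu :: real ^ 'n::finite \<Rightarrow> real)"
    and ball_mass_pos: "ball_mass TYPE('n) mu > 0"
proof -
  have e: "real 0 / 2 + real CARD('n) / 2 - 1 > -1" by simp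
  have int: "set_integrable lborel {0..1} (\<lambda>v. (1 - v) powr mu * v powr (real 0 / 2 + real CARD('n) / 2 - 1))"
    by (rule beta_integrable[OF e mu])
  have w: "ball_weight mu = (\<lambda>x::real^'n. (1 - (norm x)\<^sup>2) powr mu * 1)"
    by (simp add: ball_weight_def fun_eq_iff)
  note radial = radial_homogeneous_integral[OF one_in_homogeneous_polys _ int]
  show "set_integrable lborel (cball 0 1) (ball_weight mu :: real ^ 'n \<Rightarrow> real)"
    unfolding w by (rule radial(1)) simp
  have "ball_mass TYPE('n) mu = (LBINT v:{0..1}. (1 - v) powr mu * v powr (real 0 / 2 + real CARD('n) / 2 - 1)) *
      sphere_area TYPE('n) / 2"
    unfolding ball_mass_def w sphere_area_def by (rule radial(2)) simp
  then show "ball_mass TYPE('n) mu > 0"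
    using beta_integral_pos[OF e mu] sphere_area_pos[where 'n='n] by (metis half_gt_zero mult_pos_pos)
qed

lemma ball_sobolev_symmetric_form:
  assumes mu: "mu > -1"
  shows "symmetric_form scaleR {f :: real ^ 'n::finite \<Rightarrow> real. real_polynomial_function f} (ball_sobolev_inner mu lam)"
proof -
  have int: "set_integrable lborel (cball 0 1) (\<lambda>x. f x * g x * ball_weight mu x)"
    if "real_polynomial_function f" "real_polynomial_function g" for f g :: "real^'n \<Rightarrow> real"
    using that
    by (intro set_integrable_mult_continuous ball_weight_integrable mu compact_cball
        continuous_intros continuous_on_real_polynomial_function)
  have int': "integrable sphere_measure (\<lambda>x. normal_deriv f x * normal_deriv g x)"
    if "real_polynomial_function f" "real_polynomial_function g" for f g :: "real^'n \<Rightarrow> real"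
    using that
    by (intro integrable_sphere_measure_continuous continuous_intros continuous_on_real_polynomial_function
        real_polynomial_function_normal_deriv)
  show ?thesis
  proof (unfold_locales, goal_cases)
    case 1
    show ?case unfolding real_module_raw by (rule subspace_real_polynomial_function)
  next
    case (2 f g h)
    then have rp: "real_polynomial_function f" "real_polynomial_function g" "real_polynomial_function h" by auto
    show ?case
      unfolding ball_sobolev_inner_def plus_fun_def normal_deriv_add[OF rp(1,2)] distrib_right
      by (simp add: int int' rp set_integral_add distrib_left)
  next
    case (3 f h c)
    then have "real_polynomial_function f" by auto
    from normal_deriv_cmult[OF this] show ?case
      unfolding ball_sobolev_inner_def scaleR_fun_def real_scaleR_def
      by (simp add: mult.assoc distrib_left)
  next
    case (4 f h)
    show ?case unfolding ball_sobolev_inner_def by (simp add: mult.commute)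
  qed
qed

section \<open>Products of a radial polynomial and a homogeneous one\<close>

definition radial_mult :: "real poly \<Rightarrow> (real ^ 'n::finite \<Rightarrow> real) \<Rightarrow> real ^ 'n \<Rightarrow> real" where
  "radial_mult p Y x = poly p (2 * (norm x)\<^sup>2 - 1) * Y x"

lemma real_polynomial_function_poly:
  assumes "real_polynomial_function s"
  shows "real_polynomial_function (\<lambda>x. poly p (s x))"
  using assms by (induction p) (auto intro: real_polynomial_function.intros)

lemma real_polynomial_function_radial_arg:
  "real_polynomial_function (\<lambda>x :: real ^ 'n::finite. 2 * (norm x)\<^sup>2 - 1)"
  by (intro real_polynomial_function_diff real_polynomial_function.intros real_polynomial_function_power_norm)

lemma normal_deriv_const: "normal_deriv (\<lambda>x. c) x = 0"
  by (simp add: normal_deriv_def partial_deriv_def)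

text \<open>The chain rule, unrolled along the Horner form of \<open>p\<close>: the Euler operator
  is a derivation that kills constants and sends 2|x|^2 - 1 to 4|x|^2.\<close>

lemma normal_deriv_radial_poly:
  "normal_deriv (\<lambda>x :: real ^ 'n::finite. poly p (2 * (norm x)\<^sup>2 - 1)) x =
     4 * (norm x)\<^sup>2 * poly (pderiv p) (2 * (norm x)\<^sup>2 - 1)"
proof (induction p)
  case 0
  show ?case by (simp add: normal_deriv_const)
next
  case (pCons a p)
  let ?s = "\<lambda>x :: real^'n. 2 * (norm x)\<^sup>2 - 1"
  have rn: "real_polynomial_function (\<lambda>x :: real^'n. 2 * (norm x)\<^sup>2)"
    by (rule real_polynomial_function.intros(4)[OF real_polynomial_function.intros(2) real_polynomial_function_power_norm])
  have "normal_deriv ?s x = normal_deriv (\<lambda>x. 2 * (norm x)\<^sup>2 + (-1)) x" by simp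
  also have "\<dots> = normal_deriv (\<lambda>x. 2 * (norm x)\<^sup>2) x + normal_deriv (\<lambda>x. -1) x"
    by (rule normal_deriv_add[OF rn real_polynomial_function.intros(2)])
  also have "\<dots> = 4 * (norm x)\<^sup>2"
    by (simp add: normal_deriv_const normal_deriv_cmult[OF real_polynomial_function_power_norm]
        normal_deriv_homogeneous[OF homogeneous_polys_power_norm])
  finally have s: "normal_deriv ?s x = 4 * (norm x)\<^sup>2" .
  note rs = real_polynomial_function_radial_arg
  note rq = real_polynomial_function_poly[OF rs, of p]
  have "normal_deriv (\<lambda>x. poly (pCons a p) (?s x)) x = normal_deriv (\<lambda>x. a + ?s x * poly p (?s x)) x"
    by simp
  also have "\<dots> = normal_deriv (\<lambda>x. a) x + normal_deriv (\<lambda>x. ?s x * poly p (?s x)) x"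
    by (rule normal_deriv_add[OF real_polynomial_function.intros(2) real_polynomial_function.intros(4)[OF rs rq]])
  also have "\<dots> = ?s x * normal_deriv (\<lambda>x. poly p (?s x)) x + normal_deriv ?s x * poly p (?s x)"
    by (simp only: normal_deriv_const normal_deriv_mult[OF rs rq] add_0)
  also have "\<dots> = 4 * (norm x)\<^sup>2 * poly (pderiv (pCons a p)) (?s x)"
    unfolding s pCons.IH by (simp add: pderiv_pCons algebra_simps)
  finally show ?case .
qed

lemma normal_deriv_radial_mult_sphere:
  fixes Y :: "real ^ 'n::finite \<Rightarrow> real"
  assumes Y: "Y \<in> homogeneous_polys k" and x: "norm x = 1"
  shows "normal_deriv (radial_mult p Y) x = (real k * poly p 1 + 4 * poly (pderiv p) 1) * Y x"
proof -
  have "normal_deriv (radial_mult p Y) x =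
    poly p (2 * (norm x)\<^sup>2 - 1) * normal_deriv Y x + normal_deriv (\<lambda>x. poly p (2 * (norm x)\<^sup>2 - 1)) x * Y x"
    unfolding radial_mult_def[abs_def] using Y
    by (intro normal_deriv_mult real_polynomial_function_poly real_polynomial_function_radial_arg
        homogeneous_polys_imp_real_polynomial_function)
  then show ?thesis
    using x by (simp add: normal_deriv_radial_poly normal_deriv_homogeneous[OF Y] algebra_simps)
qed

text \<open>By the choice of \<open>A0\<close>, the factor lam / (2^k A0) equals sigma_d / (omega_mu
  2^(mu + \<gamma> + 2)) with \<gamma> = k + \<delta>. It converts the Jacobi integral into the
  normalized ball integral and cancels the scalar in front of the rank one matrix, leaving lam for
  the sphere term.\<close>

lemma ball_sobolev_inner_radial_mult:
  fixes Y Z :: "real ^ 'n::finite \<Rightarrow> real"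
  assumes mu: "mu > -1" and lam: "lam > 0"
    and \<delta>: "\<delta> = (real CARD('n) - 2) / 2"
    and A0: "A0 = lam * 2 powr (\<delta> + mu + 2) * (ball_mass TYPE('n) mu / sphere_area TYPE('n))"
    and M: "M = (2 ^ k * A0) *\<^sub>R vector [vector [(real k)\<^sup>2, 4 * real k], vector [4 * real k, 16]]"
    and Y: "Y \<in> homogeneous_polys k" and Z: "Z \<in> homogeneous_polys k"
  shows "ball_sobolev_inner mu lam (radial_mult p Y) (radial_mult q Z) =
    lam / (2 ^ k * A0) * jacobi_sobolev_inner mu (real k + \<delta>) M p q * sphere_inner Y Z"
proof -
  define K where "K = (LINT x|sphere_measure. Y x * Z x)"
  define b where "b = ball_mass TYPE('n) mu"
  define s where "s = sphere_area TYPE('n)"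
  have b: "b > 0" unfolding b_def by (rule ball_mass_pos[OF mu])
  have s: "s > 0" unfolding s_def by (rule sphere_area_pos)
  define \<gamma> where "\<gamma> = real k + \<delta>"
  have \<gamma>: "\<gamma> > -1" by (simp add: \<gamma>_def \<delta> field_simps add_pos_nonneg)
  have \<gamma>': "real (k + k) / 2 + real CARD('n) / 2 - 1 = \<gamma>" by (simp add: \<gamma>_def \<delta> field_simps)
  define G where "G = (\<lambda>v::real. poly p (2 * v - 1) * poly q (2 * v - 1) * (1 - v) powr mu)"
  have [measurable]: "poly r \<in> borel_measurable borel" for r :: "real poly"
    by (intro borel_measurable_continuous_onI continuous_intros)
  have G [measurable]: "G \<in> borel_measurable borel" unfolding G_def by measurable
  define J where "J = (LBINT t:{-1..1}. poly p t * poly q t * (1 - t) powr mu * (1 + t) powr \<gamma>)"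
  have "set_integrable lborel {0..1} (\<lambda>v. (poly p (2 * v - 1) * poly q (2 * v - 1)) * ((1 - v) powr mu * v powr \<gamma>))"
    by (intro set_integrable_mult_continuous beta_integrable mu \<gamma> continuous_intros) auto
  then have int: "set_integrable lborel {0..1} (\<lambda>v. G v * v powr \<gamma>)" by (simp add: G_def mult.assoc)
  have "J = 2 * (LBINT v:{0..1}. 2 powr (mu + \<gamma>) * (G v * v powr \<gamma>))"
    unfolding J_def set_integral_affine_unit(1)
  proof (intro arg_cong[where f = "(*) 2"] set_lebesgue_integral_cong allI impI)
    fix v :: real assume "v \<in> {0..1}"
    then have "(2 * (1 - v)) powr mu = 2 powr mu * (1 - v) powr mu" "(2 * v) powr \<gamma> = 2 powr \<gamma> * v powr \<gamma>"
      by (subst powr_mult, simp_all)+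
    then show "poly p (2 * v - 1) * poly q (2 * v - 1) * (1 - (2 * v - 1)) powr mu * (1 + (2 * v - 1)) powr \<gamma> =
        2 powr (mu + \<gamma>) * (G v * v powr \<gamma>)"
      by (simp add: powr_add right_diff_distrib G_def)
  qed simp
  then have J: "J = 2 powr (mu + \<gamma> + 1) * (LBINT v:{0..1}. G v * v powr \<gamma>)"
    by (simp add: powr_add)
  have "(LBINT x:cball 0 1. radial_mult p Y x * radial_mult q Z x * ball_weight mu x) =
      (LBINT x:cball 0 1. G ((norm x)\<^sup>2) * (Y x * Z x))"
    by (simp add: radial_mult_def G_def ball_weight_def mult_ac)
  also have "\<dots> = (LBINT v:{0..1}. G v * v powr \<gamma>) * K / 2"
    using radial_homogeneous_integral(2)[OF homogeneous_polys_mult[OF Y Z] G] int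
    unfolding \<gamma>' K_def by simp
  \<comment> \<open>The exponent collects mu + \<gamma> from 1 - t = 2(1 - v) and 1 + t = 2v, one
    from dt = 2 dv, and one from the 1/2 of polar coordinates.\<close>
  also have "\<dots> = J * K / 2 powr (mu + \<gamma> + 2)"
    by (simp add: J powr_add)
  finally have ball: "(LBINT x:cball 0 1. radial_mult p Y x * radial_mult q Z x * ball_weight mu x) =
      J * K / 2 powr (mu + \<gamma> + 2)" .
  define P where "P = (real k * poly p 1 + 4 * poly (pderiv p) 1) * (real k * poly q 1 + 4 * poly (pderiv q) 1)"
  have "(LINT x|sphere_measure. normal_deriv (radial_mult p Y) x * normal_deriv (radial_mult q Z) x) =
      (LINT x|sphere_measure. P * (Y x * Z x))"
    by (rule integral_sphere_measure_cong)
       (simp add: P_def normal_deriv_radial_mult_sphere[OF Y] normal_deriv_radial_mult_sphere[OF Z])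
  then have sphere: "(LINT x|sphere_measure. normal_deriv (radial_mult p Y) x * normal_deriv (radial_mult q Z) x) = P * K"
    by (simp add: K_def)
  have jac: "jacobi_sobolev_inner mu (real k + \<delta>) M p q = J + 2 ^ k * A0 * P"
    unfolding jacobi_sobolev_inner_def M quad_form_rank1 by (simp add: J_def P_def \<gamma>_def)
  have A0': "2 ^ k * A0 = lam * 2 powr (mu + \<gamma> + 2) * b / s"
    by (simp add: A0 b_def s_def \<gamma>_def powr_add powr_realpow mult_ac)
  have pos: "2 powr (mu + \<gamma> + 2) > 0" by simp
  show ?thesis
    unfolding ball_sobolev_inner_def ball sphere jac sphere_inner_def K_def[symmetric] b_def[symmetric]
      s_def[symmetric] A0'
    using b s lam pos by (simp add: field_simps)
qed

text \<open>Both terms of the inner product are multiples of the spherical integral of Y Z, which is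
  0. The radial exponent, now built from (k + l)/2, enters only through integrability.\<close>

lemma ball_sobolev_inner_radial_mult_orthogonal:
  fixes Y Z :: "real ^ 'n::finite \<Rightarrow> real"
  assumes mu: "mu > -1" and Y: "Y \<in> harmonic_polys k" and Z: "Z \<in> harmonic_polys l" and kl: "k \<noteq> l"
  shows "ball_sobolev_inner mu lam (radial_mult p Y) (radial_mult q Z) = 0"
proof -
  have Yh: "Y \<in> homogeneous_polys k" and Zh: "Z \<in> homogeneous_polys l"
    using Y Z by (auto simp: harmonic_polys_def)
  have K: "(LINT x|sphere_measure. Y x * Z x) = 0" by (rule harmonic_polys_orthogonal[OF Y Z kl])
  define G where "G = (\<lambda>v::real. poly p (2 * v - 1) * poly q (2 * v - 1) * (1 - v) powr mu)"
  have [measurable]: "poly r \<in> borel_measurable borel" for r :: "real poly"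
    by (intro borel_measurable_continuous_onI continuous_intros)
  have G [measurable]: "G \<in> borel_measurable borel" unfolding G_def by measurable
  define \<gamma> where "\<gamma> = real (k + l) / 2 + real CARD('n) / 2 - 1"
  have \<gamma>: "\<gamma> > -1" by (simp add: \<gamma>_def add_nonneg_pos)
  have "set_integrable lborel {0..1} (\<lambda>v. (poly p (2 * v - 1) * poly q (2 * v - 1)) * ((1 - v) powr mu * v powr \<gamma>))"
    by (intro set_integrable_mult_continuous beta_integrable mu \<gamma> continuous_intros) auto
  then have int: "set_integrable lborel {0..1} (\<lambda>v. G v * v powr \<gamma>)" by (simp add: G_def mult.assoc)
  have "(LBINT x:cball 0 1. radial_mult p Y x * radial_mult q Z x * ball_weight mu x) =
      (LBINT x:cball 0 1. G ((norm x)\<^sup>2) * (Y x * Z x))"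
    by (simp add: radial_mult_def G_def ball_weight_def mult_ac)
  also have "\<dots> = 0"
    using radial_homogeneous_integral(2)[OF homogeneous_polys_mult[OF Yh Zh] G] int K
    unfolding \<gamma>_def[symmetric] by simp
  finally have ball: "(LBINT x:cball 0 1. radial_mult p Y x * radial_mult q Z x * ball_weight mu x) = 0" .
  have "(LINT x|sphere_measure. normal_deriv (radial_mult p Y) x * normal_deriv (radial_mult q Z) x) =
      (LINT x|sphere_measure. ((real k * poly p 1 + 4 * poly (pderiv p) 1) * (real l * poly q 1 + 4 * poly (pderiv q) 1)) *
        (Y x * Z x))"
    by (rule integral_sphere_measure_cong)
       (simp add: normal_deriv_radial_mult_sphere[OF Yh] normal_deriv_radial_mult_sphere[OF Zh])
  then show ?thesis by (simp add: ball_sobolev_inner_def ball K)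
qed

lemma radial_mult_in_polys_upto:
  fixes Y :: "real ^ 'n::finite \<Rightarrow> real"
  assumes Y: "Y \<in> homogeneous_polys k" and p: "degree p \<le> j"
  shows "radial_mult p Y \<in> polys_upto (k + 2 * j)"
proof -
  \<comment> \<open>Substituting t = 2v - 1 rewrites the radial factor as a polynomial in v = |x|^2
    of the same degree; each v^i Y is homogeneous of degree 2i + k.\<close>
  define r where "r = pcompose p [:-1, 2:]"
  have hom: "(\<lambda>x. ((norm x)\<^sup>2) ^ i * Y x) \<in> homogeneous_polys (2 * i + k)" for i
  proof (induction i)
    case (Suc i)
    from homogeneous_polys_mult[OF homogeneous_polys_power_norm Suc] show ?case
      by (simp add: mult.assoc)
  qed (use Y in simp)
  have "radial_mult p Y = (\<Sum>i\<le>degree r. coeff r i *\<^sub>R (\<lambda>x. ((norm x)\<^sup>2) ^ i * Y x))"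
  proof
    fix x :: "real^'n"
    have "poly p (2 * (norm x)\<^sup>2 - 1) = poly r ((norm x)\<^sup>2)"
      by (simp add: r_def poly_pcompose algebra_simps)
    then show "radial_mult p Y x = (\<Sum>i\<le>degree r. coeff r i *\<^sub>R (\<lambda>x. ((norm x)\<^sup>2) ^ i * Y x)) x"
      by (simp add: radial_mult_def poly_altdef sum_fun_apply scaleR_fun_def sum_distrib_right mult.assoc)
  qed
  also have "\<dots> \<in> polys_upto (k + 2 * j)"
    unfolding polys_upto_def
  proof (intro span_sum span_scale)
    fix i assume "i \<in> {..degree r}"
    then have "2 * i + k \<le> k + 2 * j" using p by (simp add: r_def degree_pcompose)
    then show "(\<lambda>x. ((norm x)\<^sup>2) ^ i * Y x) \<in> span {monomial a |a. (\<Sum>i\<in>UNIV. a i) \<le> k + 2 * j}"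
      using hom homogeneous_polys_subset_polys_upto unfolding polys_upto_def by blast
  qed
  finally show ?thesis .
qed

section \<open>Total degree and the basis of the orthogonal space\<close>

lemma in_polys_upto_total_degree:
  "real_polynomial_function f \<Longrightarrow> f \<in> polys_upto (total_degree f)"
  unfolding total_degree_def real_polynomial_function_iff_polys_upto by (rule LeastI_ex)

lemma total_degree_le: "f \<in> polys_upto m \<Longrightarrow> total_degree f \<le> m"
  unfolding total_degree_def by (rule Least_le)

theorem theorem3p1:
  fixes mu lam \<delta> A0 :: real
    and \<beta> :: "nat \<Rightarrow> nat \<Rightarrow> real"
    and M :: "nat \<Rightarrow> real ^ 2 ^ 2"
    and Y :: "nat \<Rightarrow> nat \<Rightarrow> real ^ 'n::finite \<Rightarrow> real"
    and Q :: "nat \<Rightarrow> nat \<Rightarrow> nat \<Rightarrow> real ^ 'n \<Rightarrow> real"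
    and a :: "nat \<Rightarrow> nat"
    and I :: "nat \<Rightarrow> (nat \<times> nat) set"
  assumes d: "CARD('n) \<ge> 2" and mu: "mu > -1" and lam: "lam > 0"
    and \<delta>: "\<delta> = (real CARD('n) - 2) / 2"
    and \<beta>: "\<And>n j. \<beta> n j = real n - 2 * real j + \<delta>"
    and A0: "A0 = lam * 2 powr (\<delta> + mu + 2) * (ball_mass TYPE('n) mu / sphere_area TYPE('n))"
    and M: "\<And>k. M k = (2 ^ k * A0) *\<^sub>R vector [vector [(real k)\<^sup>2, 4 * real k], vector [4 * real k, 16]]"
    and a: "\<And>k. a k = dim (harmonic_polys k :: (real ^ 'n \<Rightarrow> real) set)"
    and Y_basis: "\<And>k. indexed_basis (harmonic_polys k) {1..a k} (Y k)"
    and Y_orthonormal: "\<And>k \<nu> \<nu>'. \<nu> \<in> {1..a k} \<Longrightarrow> \<nu>' \<in> {1..a k} \<Longrightarrow>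
           sphere_inner (Y k \<nu>) (Y k \<nu>') = (if \<nu> = \<nu>' then 1 else 0)"
    and Q: "\<And>n j \<nu> x. Q n j \<nu> x =
           poly (jacobi_sobolev mu (\<beta> n j) (M (n - 2 * j)) j) (2 * (norm x)\<^sup>2 - 1) * Y (n - 2 * j) \<nu> x"
    and I: "\<And>n. I n = {(j, \<nu>). 2 * j \<le> n \<and> 1 \<le> \<nu> \<and> \<nu> \<le> a (n - 2 * j)}"
  shows "\<forall>n. indexed_basis (sobolev_orth_polys mu lam n) (I n) (\<lambda>(j, \<nu>). Q n j \<nu>) \<and>
           (\<forall>(j, \<nu>) \<in> I n. \<forall>(j', \<nu>') \<in> I n. (j, \<nu>) \<noteq> (j', \<nu>') \<longrightarrow>
              ball_sobolev_inner mu lam (Q n j \<nu>) (Q n j' \<nu>') = 0) \<and>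
           (\<forall>(j, \<nu>) \<in> I n.
              ball_sobolev_inner mu lam (Q n j \<nu>) (Q n j \<nu>) =
                lam / (2 ^ (n - 2 * j) * A0) *
                jacobi_sobolev_inner mu (\<beta> n j) (M (n - 2 * j))
                  (jacobi_sobolev mu (\<beta> n j) (M (n - 2 * j)) j)
                  (jacobi_sobolev mu (\<beta> n j) (M (n - 2 * j)) j))"
proof -
  define J where "J = (\<lambda>k. jacobi_sobolev mu (real k + \<delta>) (M k))"
  define B where "B = (ball_sobolev_inner mu lam :: (real ^ 'n \<Rightarrow> real) \<Rightarrow> _)"
  \<comment> \<open>Indexing by the harmonic degree k instead of n avoids truncated subtraction and
    makes the univariate family depend on k alone; \<open>S n\<close> then collects the members with
    k + 2j = n.\<close>
  define E where "E = (\<lambda>(k, j, \<nu>). radial_mult (J k j) (Y k \<nu>))"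
  define S where "S = (\<lambda>n. E ` {(k, j, \<nu>). k + 2 * j = n \<and> \<nu> \<in> {1..a k}})"
  have A0_pos: "A0 > 0"
    unfolding A0 using lam ball_mass_pos[OF mu, where 'n='n] sphere_area_pos[where 'n='n] by simp
  have \<beta>_gt: "real k + \<delta> > -1" for k
    using d by (simp add: \<delta> field_simps add_pos_nonneg)
  have M_sym: "transpose (M k) = M k" for k
    by (simp add: M transpose_def vec_eq_iff forall_2)
  have M_psd: "0 \<le> (v v* M k) \<bullet> v" for k v
    using A0_pos by (simp add: M quad_form_rank1 mult.assoc zero_le_mult_iff)
  interpret jac: definite_poly_form "jacobi_sobolev_inner mu (real k + \<delta>) (M k)" for k
    by (rule jacobi_sobolev_inner_form[OF mu \<beta>_gt M_sym M_psd])
  interpret ball: symmetric_form scaleR "{f :: real ^ 'n \<Rightarrow> real. real_polynomial_function f}" B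
    rewrites "module.subspace (*\<^sub>R) = subspace" and "module.span (*\<^sub>R) = span"
      and "module.dependent (*\<^sub>R) = dependent"
    unfolding B_def by (rule ball_sobolev_symmetric_form[OF mu]) (simp_all add: real_module_raw)
  have J_deg: "degree (J k j) = j" and J_lc: "lead_coeff (J k j) = ((2 * real j + mu + (real k + \<delta>)) gchoose j) / 2 ^ j"
    and J_orth: "i \<noteq> j \<Longrightarrow> jacobi_sobolev_inner mu (real k + \<delta>) (M k) (J k i) (J k j) = 0" for k i j
    using is_jacobi_sobolev_seq_jacobi_sobolev[OF mu \<beta>_gt M_sym M_psd, of k]
    unfolding is_jacobi_sobolev_seq_def J_def by blast+
  have J_nz: "J k j \<noteq> 0" for k j
    using J_lc[of k j] jacobi_leading_coeff_pos[OF mu \<beta>_gt, of j k] by force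
  have Y_harm: "Y k \<nu> \<in> harmonic_polys k" if "\<nu> \<in> {1..a k}" for k \<nu>
    using Y_basis[of k] that span_base[of "Y k \<nu>" "Y k ` {1..a k}"] by (auto simp: indexed_basis_def)
  have Y_hom: "Y k \<nu> \<in> homogeneous_polys k" if "\<nu> \<in> {1..a k}" for k \<nu>
    using Y_harm[OF that] by (simp add: harmonic_polys_def)
  have Q_E: "Q n j \<nu> = E (n - 2 * j, j, \<nu>)" and \<beta>_eq: "\<beta> n j = real (n - 2 * j) + \<delta>" if "2 * j \<le> n" for n j \<nu>
  proof -
    show "\<beta> n j = real (n - 2 * j) + \<delta>" using that by (simp add: \<beta> of_nat_diff)
    then show "Q n j \<nu> = E (n - 2 * j, j, \<nu>)" by (simp add: Q E_def radial_mult_def J_def fun_eq_iff)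
  qed
  have QS: "(\<lambda>(j, \<nu>). Q n j \<nu>) ` I n = S n" for n
  proof (intro equalityI subsetI)
    fix f assume "f \<in> (\<lambda>(j, \<nu>). Q n j \<nu>) ` I n"
    then obtain j \<nu> where "(j, \<nu>) \<in> I n" "f = Q n j \<nu>" by auto
    then show "f \<in> S n"
      unfolding S_def using Q_E[of j n \<nu>] by (intro image_eqI[of _ _ "(n - 2 * j, j, \<nu>)"]) (auto simp: I)
  next
    fix f assume "f \<in> S n"
    then obtain k j \<nu> where *: "f = E (k, j, \<nu>)" "k + 2 * j = n" "\<nu> \<in> {1..a k}" unfolding S_def by auto
    then have "n - 2 * j = k" "2 * j \<le> n" by auto
    then show "f \<in> (\<lambda>(j, \<nu>). Q n j \<nu>) ` I n"
      using * Q_E[of j n \<nu>] by (intro image_eqI[of _ _ "(j, \<nu>)"]) (auto simp: I)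
  qed
  have inner_E: "B (E (k, j, \<nu>)) (E (k, j', \<nu>')) =
      lam / (2 ^ k * A0) * jacobi_sobolev_inner mu (real k + \<delta>) (M k) (J k j) (J k j') * (if \<nu> = \<nu>' then 1 else 0)"
    if "\<nu> \<in> {1..a k}" "\<nu>' \<in> {1..a k}" for k j j' \<nu> \<nu>'
    using ball_sobolev_inner_radial_mult[OF mu lam \<delta> A0 M[of k] Y_hom[OF that(1)] Y_hom[OF that(2)], of "J k j" "J k j'"]
      Y_orthonormal[OF that] by (simp add: B_def E_def)
  have E_orth: "B (E (k, j, \<nu>)) (E (k', j', \<nu>')) = 0"
    if "\<nu> \<in> {1..a k}" "\<nu>' \<in> {1..a k'}" "(k, j, \<nu>) \<noteq> (k', j', \<nu>')" for k k' j j' \<nu> \<nu>'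
  proof (cases "k = k'")
    \<comment> \<open>For equal k, either the harmonics differ and are orthonormal, or the radial
      indices differ and the univariate polynomials are orthogonal.\<close>
    case True
    then show ?thesis using inner_E[of \<nu> k \<nu>' j j'] J_orth[of j j' k] that by (cases "\<nu> = \<nu>'") auto
  next
    case False
    then show ?thesis
      using ball_sobolev_inner_radial_mult_orthogonal[OF mu Y_harm[OF that(1)] Y_harm[OF that(2)]]
      by (simp add: B_def E_def)
  qed
  have E_self: "B (E (k, j, \<nu>)) (E (k, j, \<nu>)) \<noteq> 0" if "\<nu> \<in> {1..a k}" for k j \<nu>
  proof -
    have "jacobi_sobolev_inner mu (real k + \<delta>) (M k) (J k j) (J k j) \<noteq> 0"
      using jac.form_self_eq_0[of k "J k j"] J_nz[of k j] by blast
    then show ?thesis using inner_E[OF that that, of j j] lam A0_pos by simp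
  qed
  \<comment> \<open>Equal functions with different indices would be orthogonal to themselves,
    contrary to \<open>E_self\<close>.\<close>
  have E_inj: "t = t'" if "E t = E t'" "t \<in> {(k, j, \<nu>). \<nu> \<in> {1..a k}}" "t' \<in> {(k, j, \<nu>). \<nu> \<in> {1..a k}}" for t t'
  proof (rule ccontr)
    assume "t \<noteq> t'"
    moreover obtain k j \<nu> k' j' \<nu>' where "t = (k, j, \<nu>)" "t' = (k', j', \<nu>')" by (metis prod_cases3)
    ultimately show False using E_orth[of \<nu> k \<nu>' k' j j'] E_self[of \<nu> k j] that by auto
  qed
  have S_upto: "S m \<subseteq> polys_upto m" for m
    unfolding S_def E_def using Y_hom J_deg by (auto intro!: radial_mult_in_polys_upto)
  have S_rp: "S m \<subseteq> {f. real_polynomial_function f}" for m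
    using S_upto[of m] polys_upto_imp_real_polynomial_function by blast
  have S_self: "B s s \<noteq> 0" if "s \<in> S m" for s m
    using that E_self by (auto simp: S_def)
  have S_orth: "B s t = 0" if st: "s \<in> S m" "t \<in> S m'" "s \<noteq> t" for s t m m'
  proof -
    obtain k j \<nu> where s: "s = E (k, j, \<nu>)" "\<nu> \<in> {1..a k}"
      using st(1) unfolding S_def by auto
    obtain k' j' \<nu>' where t: "t = E (k', j', \<nu>')" "\<nu>' \<in> {1..a k'}"
      using st(2) unfolding S_def by auto
    have "(k, j, \<nu>) \<noteq> (k', j', \<nu>')" using st(3) s t by metis
    then show ?thesis unfolding s(1) t(1) by (rule E_orth[OF s(2) t(2)])
  qed
  have upto_span: "polys_upto n \<subseteq> span (\<Union>m\<le>n. S m)" for n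
  proof
    fix f :: "real ^ 'n \<Rightarrow> real" assume "f \<in> polys_upto n"
    then obtain g where g: "\<forall>m. g m \<in> homogeneous_polys m" "f = (\<Sum>m\<le>n. g m)"
      using polys_upto_decompose by blast
    have "homogeneous_polys m \<subseteq> span (\<Union>m\<le>n. S m)" if "m \<le> n" for m
    proof (rule homogeneous_polys_subset_if_harmonic[OF subspace_span])
      fix j :: nat and Y' :: "real ^ 'n \<Rightarrow> real"
      assume j: "2 * j \<le> m" and Y': "Y' \<in> harmonic_polys (m - 2 * j)"
      define k where "k = m - 2 * j"
      define L where "L = (\<lambda>(Z :: real^'n \<Rightarrow> real) x. ((norm x)\<^sup>2) ^ j * Z x)"
      have lin: "linear L" by (rule linearI) (auto simp: L_def plus_fun_def scaleR_fun_def algebra_simps)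
      \<comment> \<open>Linearity of multiplication by |x|^(2j) reduces an arbitrary harmonic to the
        chosen basis of its space.\<close>
      have "span (Y k ` {1..a k}) \<subseteq> L -` span (\<Union>m\<le>n. S m)"
      proof (rule span_minimal)
        show "subspace (L -` span (\<Union>m\<le>n. S m))" by (rule linear_subspace_vimage[OF lin subspace_span])
        show "Y k ` {1..a k} \<subseteq> L -` span (\<Union>m\<le>n. S m)"
        proof clarsimp
          fix \<nu> assume \<nu>: "Suc 0 \<le> \<nu>" "\<nu> \<le> a k"
          define R where "R = (\<lambda>p. radial_mult p (Y k \<nu>))"
          \<comment> \<open>This is ((1 + t)/2)^j, which at t = 2|x|^2 - 1 equals |x|^(2j). Its
            degree is at most j, so it expands in the Sobolev polynomials of index at most j, and
            \<open>R\<close> carries the expansion to the ball linearly.\<close>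
          define r :: "real poly" where "r = [:1/2, 1/2:] ^ j"
          have "degree r \<le> j" unfolding r_def by (rule order_trans[OF degree_power_le]) simp
          then have "r \<in> module.span smult (J k ` {..<Suc j})"
            by (intro jac.in_span_triangular J_deg J_nz) (auto intro: coeff_eq_0)
          then have "R r \<in> span (\<Union>m\<le>n. S m)"
          proof (induction rule: jac.span_induct_alt)
            case base
            have "R 0 = 0" by (auto simp: R_def radial_mult_def fun_eq_iff)
            then show ?case by (simp only: span_zero)
          next
            case (step c p q)
            then obtain i where i: "p = J k i" "i \<le> j" by auto
            have "R p \<in> S (k + 2 * i)" unfolding S_def R_def i E_def using \<nu> by force
            moreover have "k + 2 * i \<le> n" using i j \<open>m \<le> n\<close> by (simp add: k_def)
            ultimately have "R p \<in> span (\<Union>m\<le>n. S m)" by (intro span_base) auto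
            moreover have "R (smult c p + q) = c *\<^sub>R R p + R q"
              by (simp add: R_def radial_mult_def fun_eq_iff scaleR_fun_def plus_fun_def algebra_simps)
            ultimately show ?case using step.IH by (simp only: span_add span_scale)
          qed
          moreover have "R r = L (Y k \<nu>)"
            by (simp add: R_def L_def r_def radial_mult_def fun_eq_iff poly_power field_simps)
          ultimately show "L (Y k \<nu>) \<in> span (\<Union>m\<le>n. S m)" by simp
        qed
      qed
      then show "(\<lambda>x. ((norm x)\<^sup>2) ^ j * Y' x) \<in> span (\<Union>m\<le>n. S m)"
        using Y' Y_basis[of k] by (auto simp: indexed_basis_def k_def L_def)
    qed
    then show "f \<in> span (\<Union>m\<le>n. S m)" unfolding g(2) using g(1) by (intro span_sum) auto
  qed
  have lower_S: "t \<in> S m \<Longrightarrow> real_polynomial_function t \<and> total_degree t \<le> m" for t m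
    using S_upto[of m] S_rp[of m] total_degree_le by blast
  have disjoint_S: "S m \<inter> S m' = {}" if "m \<noteq> m'" for m m'
  proof (rule ccontr)
    assume "S m \<inter> S m' \<noteq> {}"
    then obtain f where f: "f \<in> S m" "f \<in> S m'" by blast
    obtain k j \<nu> where "f = E (k, j, \<nu>)" "\<nu> \<in> {1..a k}" "k + 2 * j = m"
      using f(1) unfolding S_def by auto
    moreover obtain k' j' \<nu>' where "f = E (k', j', \<nu>')" "\<nu>' \<in> {1..a k'}" "k' + 2 * j' = m'"
      using f(2) unfolding S_def by auto
    ultimately have *: "E (k, j, \<nu>) = E (k', j', \<nu>')" "\<nu> \<in> {1..a k}" "\<nu>' \<in> {1..a k'}"
      "k + 2 * j = m" "k' + 2 * j' = m'"
      by auto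
    then have "(k, j, \<nu>) = (k', j', \<nu>')" by (intro E_inj) auto
    then show False using * that by simp
  qed
  have orth_complement: "f \<in> span (S n)"
    if f: "f \<in> span (\<Union>m\<le>n. S m)" and orth: "\<And>m s. m < n \<Longrightarrow> s \<in> S m \<Longrightarrow> B f s = 0" for f n
  \<comment> \<open>Orthogonality to the lower families removes them from the expansion, leaving
    \<open>S n\<close>.\<close>
  proof (rule ball.orthogonal_complement_in_span[of "\<Union>m<n. S m"])
    show "f \<in> span ((\<Union>m<n. S m) \<union> S n)"
      using f by (simp add: lessThan_Suc_atMost[symmetric] lessThan_Suc Un_commute)
  qed (use S_rp S_self S_orth orth in blast)+
  have V_span: "sobolev_orth_polys mu lam n = span (S n)" for n
  proof (intro equalityI subsetI)
    fix f :: "real ^ 'n \<Rightarrow> real" assume f: "f \<in> sobolev_orth_polys mu lam n"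
    show "f \<in> span (S n)"
    proof (cases "f = 0")
      case False
      then have "real_polynomial_function f" "total_degree f = n"
        using f by (auto simp: sobolev_orth_polys_def)
      then have "f \<in> span (\<Union>m\<le>n. S m)" using in_polys_upto_total_degree upto_span by blast
      moreover have "B f s = 0" if "m < n" "s \<in> S m" for m s
        using f lower_S[OF that(2)] that(1) by (auto simp: sobolev_orth_polys_def B_def)
      ultimately show ?thesis by (rule orth_complement)
    qed (simp add: span_zero)
  next
    fix f :: "real ^ 'n \<Rightarrow> real" assume f: "f \<in> span (S n)"
    have upto: "f \<in> polys_upto n"
      using f span_minimal[OF S_upto[of n]] by (auto simp: polys_upto_def)
    then have rp: "real_polynomial_function f" by (rule polys_upto_imp_real_polynomial_function)
    have orth_S: "B f s = 0" if "s \<in> S m" "m \<noteq> n" for s m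
    proof -
      have rs: "real_polynomial_function s" using that S_rp by blast
      have "B s f = 0"
        by (rule ball.orthogonal_to_span[OF S_rp _ _ f]) (use rs that S_orth disjoint_S in blast)+
      then show ?thesis using ball.form_commute[of f s] rp rs by simp
    qed
    have orth: "B f g = 0" if "real_polynomial_function g" "total_degree g < n" for g
    proof (rule ball.orthogonal_to_span[of "\<Union>m\<le>total_degree g. S m"])
      show "g \<in> span (\<Union>m\<le>total_degree g. S m)"
        using in_polys_upto_total_degree[OF that(1)] upto_span by blast
      show "B f s = 0" if "s \<in> (\<Union>m\<le>total_degree g. S m)" for s
        using orth_S that \<open>total_degree g < n\<close> by auto
    qed (use S_rp rp in blast)+
    moreover have "f = 0 \<or> total_degree f = n"
    proof (cases "total_degree f = n")
      case False
      then have less: "total_degree f < n" using total_degree_le[OF upto] by simp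
      \<comment> \<open>A member of the span of \<open>S n\<close> with smaller degree would lie in
        the span of lower families while being orthogonal to all of them. The empty complement
        forces it to be 0, which gives the exact degree condition.\<close>
      have "f \<in> span ({} :: (real ^ 'n \<Rightarrow> real) set)"
      proof (rule ball.orthogonal_complement_in_span[of "\<Union>m\<le>total_degree f. S m"])
        show "f \<in> span ((\<Union>m\<le>total_degree f. S m) \<union> {})"
          using in_polys_upto_total_degree[OF rp] upto_span by auto
        show "B f s = 0" if "s \<in> (\<Union>m\<le>total_degree f. S m)" for s
          using orth_S that less by auto
      qed (use S_rp S_self S_orth in auto)
      then show ?thesis by simp
    qed simp
    ultimately show "f \<in> sobolev_orth_polys mu lam n"
      using rp by (auto simp: sobolev_orth_polys_def B_def)
  qed
  have basis: "indexed_basis (sobolev_orth_polys mu lam n) (I n) (\<lambda>(j, \<nu>). Q n j \<nu>)" for n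
    unfolding indexed_basis_def QS V_span
  proof (intro conjI refl)
    show "inj_on (\<lambda>(j, \<nu>). Q n j \<nu>) (I n)"
    proof (rule inj_onI, clarify)
      fix j \<nu> j' \<nu>' assume jn: "(j, \<nu>) \<in> I n" "(j', \<nu>') \<in> I n" and eq: "Q n j \<nu> = Q n j' \<nu>'"
      then have "(n - 2 * j, j, \<nu>) = (n - 2 * j', j', \<nu>')"
        by (intro E_inj) (auto simp: I Q_E)
      then show "j = j' \<and> \<nu> = \<nu>'" by simp
    qed
    show "independent (S n)"
      by (rule ball.orthogonal_imp_independent) (use S_rp S_self S_orth in blast)+
  qed
  have orthogonal: "ball_sobolev_inner mu lam (Q n j \<nu>) (Q n j' \<nu>') = 0"
    if "(j, \<nu>) \<in> I n" "(j', \<nu>') \<in> I n" "(j, \<nu>) \<noteq> (j', \<nu>')" for n j \<nu> j' \<nu>'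
    using that E_orth[of \<nu> "n - 2 * j" \<nu>' "n - 2 * j'" j j'] by (auto simp: I Q_E B_def)
  have norm: "ball_sobolev_inner mu lam (Q n j \<nu>) (Q n j \<nu>) =
      lam / (2 ^ (n - 2 * j) * A0) *
        jacobi_sobolev_inner mu (\<beta> n j) (M (n - 2 * j))
          (jacobi_sobolev mu (\<beta> n j) (M (n - 2 * j)) j)
          (jacobi_sobolev mu (\<beta> n j) (M (n - 2 * j)) j)"
    if "(j, \<nu>) \<in> I n" for n j \<nu>
    using that inner_E[of \<nu> "n - 2 * j" \<nu> j j] by (auto simp: I Q_E B_def \<beta>_eq J_def)
  show ?thesis
    using basis orthogonal norm by auto
qed

end
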